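(* Let $C\ge 2$ be an integer. Let $h_1,h_2:\mathbb{Z}^+\to\mathbb{R}^+$ be any functions with $h_2(n)\to\infty$ as $n\to\infty$. Then there exist a totally uniquely ergodic topological dynamical system $(X,T)$ (with metric $d$ on $X$), a sequence $(q_n)$ of primes satisfying $$\sup_{x\in X}d(x,T^{q_n}x)=o(h_1(q_n))\quad\text{as } n\to\infty,$$ and a sequence $(r_n)$ of squarefree positive integers, pairwise coprime, satisfying $\omega(r_n)<h_2(r_n)$ for all $n$, such that for some function $f\in C(X)$ and some point $x\in X$ the limit $$\lim_{n\to\infty}\frac1{r_n}\sum_{0\le i<r_n}\mathrm{Pow}_{r_n}(i)\cdot f(T^ix)$$ does not exist.
   Context: A topological dynamical system is a pair $(X,T)$ with $X$ a compact metric space and $T:X\to X$ a homeomorphism. It is uniquely ergodic if there is exactly one $T$-invariant Borel probability measure on $X$, and totally uniquely ergodic if $(X,T^n)$ is uniquely ergodic for every positive integer $n$. $\omega(m)$ is the number of distinct prime divisors of $m$. For a positive integer $N$ and an integer $x$, $\mathrm{Pow}_N(x)=|\{t\in\{1,\dots,N\}: t^C\equiv x\pmod N\}|$. $\mathbb{R}^+$ denotes the positive reals. *)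

theory Defs
  imports
    "HOL-Probability.Probability"
    "HOL-Number_Theory.Number_Theory"
    "HOL-Computational_Algebra.Computational_Algebra"
    "HOL-Library.Landau_Symbols"
begin

definition topological_dynamical_system ::
    "'a set \<Rightarrow> ('a \<Rightarrow> 'a \<Rightarrow> real) \<Rightarrow> ('a \<Rightarrow> 'a) \<Rightarrow> bool" where
  "topological_dynamical_system X d T \<longleftrightarrow>
     Metric_space X d \<and>
     compact_space (Metric_space.mtopology X d) \<and>
     homeomorphic_map (Metric_space.mtopology X d) (Metric_space.mtopology X d) T"

definition metric_borel :: "'a set \<Rightarrow> ('a \<Rightarrow> 'a \<Rightarrow> real) \<Rightarrow> 'a measure" where
  "metric_borel X d = sigma X {U. openin (Metric_space.mtopology X d) U}"

definition invariant_prob_measure ::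
    "'a set \<Rightarrow> ('a \<Rightarrow> 'a \<Rightarrow> real) \<Rightarrow> ('a \<Rightarrow> 'a) \<Rightarrow> 'a measure \<Rightarrow> bool" where
  "invariant_prob_measure X d T \<mu> \<longleftrightarrow>
     prob_space \<mu> \<and> sets \<mu> = sets (metric_borel X d) \<and>
     (\<forall>A \<in> sets \<mu>. emeasure \<mu> (T -` A \<inter> X) = emeasure \<mu> A)"

definition uniquely_ergodic ::
    "'a set \<Rightarrow> ('a \<Rightarrow> 'a \<Rightarrow> real) \<Rightarrow> ('a \<Rightarrow> 'a) \<Rightarrow> bool" where
  "uniquely_ergodic X d T \<longleftrightarrow>
     topological_dynamical_system X d T \<and> (\<exists>!\<mu>. invariant_prob_measure X d T \<mu>)"

definition totally_uniquely_ergodic ::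
    "'a set \<Rightarrow> ('a \<Rightarrow> 'a \<Rightarrow> real) \<Rightarrow> ('a \<Rightarrow> 'a) \<Rightarrow> bool" where
  "totally_uniquely_ergodic X d T \<longleftrightarrow>
     topological_dynamical_system X d T \<and> (\<forall>n>0. uniquely_ergodic X d (T ^^ n))"

definition num_prime_divisors :: "nat \<Rightarrow> nat" where
  "num_prime_divisors m = card {p. prime p \<and> p dvd m}"

(* The exponent C, left implicit in the notation Pow_N(x), is the first argument. *)
definition power_count :: "nat \<Rightarrow> nat \<Rightarrow> int \<Rightarrow> nat" where
  "power_count C N x = card {t \<in> {1..N}. [int t ^ C = x] (mod int N)}"

end

(*
  The system is a skew product T(z, w) = (a z, w * gam z) on the torus, found by a Baire category
  argument in the closure of the set of conjugates of rotations (z, w) |-> (a z, b w) by maps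
  (z, w) |-> (z, w * cis (G z)).  Three kinds of open conditions are dense there, because inside the
  set one may perturb a and b to roots of prescribed unimodular numbers:
  - some power T^q with q prime is extremely close to the identity (a^q = b^q = 1);
  - for every m > 0, powers of T^m come close to every vertical rotation (a^n = 1 and b^n = beta),
    and powers of a^m come close to every point of the circle.  An invariant measure of T^m is then
    invariant under vertical rotations, and its first marginal under all rotations, so that it is
    Haar measure;
  - for c = 1 and c = -1, the power average along some r of f(z, w) = w at the point (1, 1) is within
    1/2 of c.
  For the third kind, let r be a product of w large primes p, each having nontrivial C-th roots of
  unity.  For every such p and every j not divisible by p, a positive proportion (depending on C
  only) of all t satisfies: t^C + j is not a C-th power mod p.  By the Chinese remainder theorem, for
  large w most t are such that t^C mod r has no other C-th power residue mod r within a given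
  distance L.  A function varying slowly along orbits can thus be added to G which turns the second
  coordinate of T^i(1, 1) into c for most C-th power residues i mod r.
*)
theory Submission
  imports Defs
begin

section \<open>Isolated power residues\<close>

text \<open>Each generic condition is a union of conditions on finitely many iterates, hence open;
  only density needs work. It is a finite problem because the cocycle of a coboundary telescopes.
  The quantities are chosen in a fixed order. The allowed distance fixes the allowed phase change
  \<open>\<delta>\<close> per iterate. Prescribed phases may differ by 2 pi, so they need gaps
  \<open>L\<close> with 2 pi \<le> \<open>\<delta>\<close> * \<open>L\<close>. Then \<open>L\<close>
  and \<open>C\<close> fix the number \<open>w\<close> of primes that makes non-isolated residues
  rare. Only then are the primes chosen, so large that \<open>h2 r\<close> exceeds \<open>w\<close>;
  thus slow growth of \<open>h2\<close> does no harm. Isolation needs C-th powers that miss a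
  positive proportion of the residues modulo p. If C is coprime to p - 1, every residue is a C-th
  power, hence the search for primes with nontrivial C-th roots of unity. All prime factors of the
  moduli can be kept above any bound, so one generic system supplies pairwise coprime moduli whose
  averages lie alternately near 1 and -1.\<close>

lemma ex_prime_nontrivial_root_of_unity:
  fixes C N :: nat
  assumes "C \<ge> 2"
  shows "\<exists>p z. prime p \<and> p > N \<and> [z ^ C = 1] (mod p) \<and> \<not> [z = 1] (mod p)"
proof -
  \<comment> \<open>\<open>F\<close> is (x^C - 1) / (x - 1), and a prime factor p of it will serve
    with z = x. Since \<open>F\<close> is 1 modulo x, p divides neither C nor N!, so p > N; and x =
    1 modulo p would make \<open>F\<close> congruent to C.\<close>
  define x where "x = C * fact N"
  define F where "F = (\<Sum>i<C. x ^ i)"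
  have x2: "x \<ge> 2" unfolding x_def using assms mult_le_mono[OF assms fact_ge_1[of N]] by simp
  obtain C' where C': "C = Suc (Suc C')" using assms by (metis add_2_eq_Suc le_Suc_ex)
  have F: "F = 1 + x * (\<Sum>i<Suc C'. x ^ i)"
    unfolding F_def C' by (subst sum.lessThan_Suc_shift) (simp add: sum_distrib_left distrib_left)
  moreover have "(\<Sum>i<Suc C'. x ^ i) \<ge> 1"
    by (subst sum.lessThan_Suc_shift) simp
  ultimately have "F > 1" using x2 by simp
  then obtain p where p: "prime p" "p dvd F" by (metis less_irrefl prime_factor_nat)
  have ndvd: "\<not> p dvd x"
  proof
    assume "p dvd x"
    then have "p dvd 1" using p(2) unfolding F by (metis dvd_add_left_iff dvd_mult2)
    then show False using p(1) by simp
  qed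
  have "p > N"
  proof (rule ccontr)
    assume "\<not> p > N"
    then have "p dvd fact N" using p(1) by (simp add: prime_dvd_fact_iff)
    then show False using ndvd unfolding x_def by simp
  qed
  moreover have "[x ^ C = 1] (mod p)"
  proof -
    have "int x ^ C - 1 = (int x - 1) * int F"
      unfolding F_def using power_diff_1_eq[of "int x" C] by simp
    then have "int p dvd int x ^ C - 1" using p(2) by simp
    then have "[int (x ^ C) = int 1] (mod int p)" by (simp add: cong_iff_dvd_diff)
    then show ?thesis using cong_int_iff by blast
  qed
  moreover have "\<not> [x = 1] (mod p)"
  proof
    assume "[x = 1] (mod p)"
    then have "[x ^ i = 1] (mod p)" for i using cong_pow[of x 1 p i] by simp
    then have "[F = (\<Sum>i<C. 1)] (mod p)" unfolding F_def by (intro cong_sum) auto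
    then have "p dvd C" using p(2) by (simp add: cong_dvd_iff)
    then show False using ndvd unfolding x_def by simp
  qed
  ultimately show ?thesis using p(1) by blast
qed

section \<open>Translates of the set of C-th powers modulo a prime\<close>

definition power_residues :: "nat \<Rightarrow> nat \<Rightarrow> nat set" where
  "power_residues C p = (\<lambda>x. x ^ C mod p) ` {..<p}"

text \<open>For \<open>Q\<close> inside {0..<p} this is half the size of the symmetric difference of
  \<open>Q\<close> and its translate by j modulo p, which explains the subadditivity in j.\<close>

definition escape :: "nat set \<Rightarrow> nat \<Rightarrow> nat \<Rightarrow> nat" where
  "escape Q p j = card {v \<in> Q. (v + j) mod p \<notin> Q}"

lemma mem_power_residuesI: "p > 0 \<Longrightarrow> x ^ C mod p \<in> power_residues C p"
  unfolding power_residues_def by (rule image_eqI[of _ _ "x mod p"]) (simp_all add: power_mod)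

lemma power_residues_subset: "p > 0 \<Longrightarrow> power_residues C p \<subseteq> {..<p}"
  unfolding power_residues_def by auto

lemma finite_power_residues [simp]: "finite (power_residues C p)"
  unfolding power_residues_def by auto

lemma escape_mod: "escape Q p (j mod p) = escape Q p j"
  unfolding escape_def by (simp add: mod_simps)

text \<open>A point of \<open>Q\<close> that leaves under i + j either leaves under i already, or
  lands in \<open>Q\<close> and leaves from there under j.\<close>

lemma escape_add:
  assumes "Q \<subseteq> {..<p}"
  shows "escape Q p (i + j) \<le> escape Q p i + escape Q p j"
proof -
  have fin: "finite Q" by (rule finite_subset[OF assms]) simp
  let ?A = "{v \<in> Q. (v + i) mod p \<notin> Q}"
  let ?B = "{v \<in> Q. (v + i) mod p \<in> Q \<and> ((v + i) mod p + j) mod p \<notin> Q}"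
  have "inj_on (\<lambda>v. (v + i) mod p) ?B"
  proof (rule inj_onI)
    fix v w assume *: "v \<in> ?B" "w \<in> ?B" "(v + i) mod p = (w + i) mod p"
    then have "[v = w] (mod p)" by (metis cong_add_rcancel_nat cong_def)
    moreover have "v < p" "w < p" using * assms by auto
    ultimately show "v = w" by (simp add: cong_less_modulus_unique_nat)
  qed
  then have "card ?B = card ((\<lambda>v. (v + i) mod p) ` ?B)" by (simp add: card_image)
  also have "\<dots> \<le> escape Q p j" unfolding escape_def using fin
    by (intro card_mono) auto
  finally have B: "card ?B \<le> escape Q p j" .
  have "escape Q p (i + j) \<le> card (?A \<union> ?B)" unfolding escape_def using fin
    by (intro card_mono) (auto simp: mod_simps add.assoc)
  also have "\<dots> \<le> card ?A + card ?B" by (rule card_Un_le)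
  finally show ?thesis using B unfolding escape_def by linarith
qed

text \<open>With t inverse to s, multiplication by \<open>t ^ C\<close> maps the power residues
  injectively into themselves and turns a shift by \<open>s ^ C * j\<close> into a shift by j.
  Applied to t as well, this makes \<open>escape\<close> constant on cosets of the nonzero C-th
  powers.\<close>

lemma escape_mult_power_le:
  assumes p: "prime p" and s: "\<not> p dvd s"
  shows "escape (power_residues C p) p (s ^ C * j) \<le> escape (power_residues C p) p j"
proof -
  let ?Q = "power_residues C p"
  have p0: "p > 0" using p by (simp add: prime_gt_0_nat)
  have "coprime s p" using p s by (metis coprime_commute prime_imp_coprime)
  then obtain t where t: "[s * t = 1] (mod p)" using cong_solve_coprime_nat by auto
  have stC: "[s ^ C * t ^ C = 1] (mod p)"
    using cong_pow[OF t, of C] by (simp add: power_mult_distrib)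
  have Qmul: "(x ^ C * v) mod p \<in> ?Q" if "v \<in> ?Q" for x v
  proof -
    obtain y where y: "v = y ^ C mod p" using \<open>v \<in> ?Q\<close> unfolding power_residues_def by auto
    have "(x ^ C * v) mod p = (x * y) ^ C mod p"
      unfolding y by (simp add: mod_simps power_mult_distrib)
    then show ?thesis using mem_power_residuesI[OF p0] by metis
  qed
  let ?f = "\<lambda>v. (t ^ C * v) mod p"
  let ?A = "{v \<in> ?Q. (v + s ^ C * j) mod p \<notin> ?Q}"
  have inv: "(s ^ C * ?f v) mod p = v mod p" for v
  proof -
    have "[s ^ C * (t ^ C * v) = 1 * v] (mod p)" using cong_scalar_right[OF stC, of v] by (simp add: mult.assoc)
    then show ?thesis by (simp add: cong_def mod_simps)
  qed
  have "inj_on ?f ?A"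
  proof (rule inj_onI)
    fix v w assume *: "v \<in> ?A" "w \<in> ?A" "?f v = ?f w"
    then have "v mod p = w mod p" using inv by metis
    moreover have "v < p" "w < p" using * power_residues_subset[OF p0, of C] by auto
    ultimately show "v = w" by simp
  qed
  then have "card ?A = card (?f ` ?A)" by (simp add: card_image)
  also have "\<dots> \<le> escape ?Q p j" unfolding escape_def
  proof (intro card_mono)
    show "?f ` ?A \<subseteq> {v \<in> ?Q. (v + j) mod p \<notin> ?Q}"
    proof (clarsimp simp: Qmul)
      fix v assume v: "v \<in> ?Q" "(v + s ^ C * j) mod p \<notin> ?Q" "(t ^ C * v mod p + j) mod p \<in> ?Q"
      have "(s ^ C * ((?f v + j) mod p)) mod p \<in> ?Q" using v Qmul by blast
      also have "(s ^ C * ((?f v + j) mod p)) mod p = (s ^ C * ?f v + s ^ C * j) mod p"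
        by (metis distrib_left mod_mult_right_eq)
      also have "\<dots> = (v + s ^ C * j) mod p" using inv by (metis mod_add_left_eq)
      finally show False using v by simp
    qed
  qed auto
  finally show ?thesis unfolding escape_def .
qed

text \<open>A polynomial of degree C has at most C roots modulo p, so no fibre of the power map
  exceeds C. The second bound concerns the group of nonzero C-th powers.\<close>

lemma card_power_residues:
  assumes p: "prime p" and C: "C > 0"
  shows "p \<le> C * card (power_residues C p)"
    and "p - 1 \<le> C * card ((\<lambda>s. s ^ C mod p) ` {0<..<p})"
proof -
  have fib: "card {x \<in> A. x ^ C mod p = v} \<le> C" if "A \<subseteq> {..<p}" for A v
  proof -
    have "{x \<in> A. x ^ C mod p = v} \<subseteq> {x \<in> {..<p}. [x ^ C = v] (mod p)}"
      using that by (auto simp: cong_def)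
    then have "card {x \<in> A. x ^ C mod p = v} \<le> card {x \<in> {..<p}. [x ^ C = v] (mod p)}"
      by (intro card_mono) auto
    also have "\<dots> \<le> C" using roots_mod_prime_bound[OF p C] .
    finally show ?thesis .
  qed
  have gen: "card A \<le> C * card ((\<lambda>s. s ^ C mod p) ` A)" if A: "A \<subseteq> {..<p}" for A
  proof -
    have fA: "finite A" by (rule finite_subset[OF A]) simp
    have "card A = (\<Sum>v\<in>(\<lambda>s. s ^ C mod p) ` A. card {x \<in> A. x ^ C mod p = v})"
      using sum.image_gen[OF fA, of "\<lambda>_. 1::nat" "\<lambda>s. s ^ C mod p"] by simp
    also have "\<dots> \<le> (\<Sum>v\<in>(\<lambda>s. s ^ C mod p) ` A. C)" by (intro sum_mono fib A)
    finally show ?thesis by (simp add: mult.commute)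
  qed
  show "p \<le> C * card (power_residues C p)"
    using gen[of "{..<p}"] unfolding power_residues_def by simp
  show "p - 1 \<le> C * card ((\<lambda>s. s ^ C mod p) ` {0<..<p})"
    using gen[of "{0<..<p}"] by (simp add: subset_eq)
qed

text \<open>Each nonzero power has the two distinct roots x and z * x, so there are at most (p - 1)
  / 2 nonzero powers; the residue 0 accounts for the rest.\<close>

lemma card_power_residues_upper:
  assumes p: "prime p" and z: "[z ^ C = 1] (mod p)" "\<not> [z = 1] (mod p)" and C: "C > 0"
  shows "2 * card (power_residues C p) \<le> p + 1"
proof -
  have p0: "p > 0" using p by (simp add: prime_gt_0_nat)
  let ?f = "\<lambda>s. s ^ C mod p"
  let ?A = "{0<..<p}"
  have nz: "\<not> p dvd z"
  proof
    assume "p dvd z"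
    then have "p dvd z ^ C" using C by (simp add: prime_dvd_power_iff p)
    then have "p dvd 1" using z(1) cong_dvd_iff by blast
    then show False using p by simp
  qed
  have two: "2 \<le> card {x \<in> ?A. ?f x = v}" if v: "v \<in> ?f ` ?A" for v
  proof -
    obtain x where x: "0 < x" "x < p" "v = x ^ C mod p" using v by auto
    have nx: "\<not> p dvd x" using x by (simp add: nat_dvd_not_less)
    define y where "y = (z * x) mod p"
    have "\<not> p dvd z * x" using nx nz p by (simp add: prime_dvd_mult_iff)
    then have y: "0 < y" "y < p" unfolding y_def using p0 by (auto simp: dvd_eq_mod_eq_0)
    have "[z ^ C * x ^ C = 1 * x ^ C] (mod p)" using cong_scalar_right z(1) by blast
    then have yv: "y ^ C mod p = v"
      unfolding y_def x(3) by (simp add: mod_simps power_mult_distrib cong_def)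
    have "x \<noteq> y"
    proof
      assume "x = y"
      then have "[z * x = 1 * x] (mod p)" unfolding y_def by (metis cong_def mod_mod_trivial mult_1)
      moreover have "coprime x p" using p nx by (metis coprime_commute prime_imp_coprime)
      ultimately have "[z = 1] (mod p)" using cong_mult_rcancel_nat by blast
      then show False using z(2) by simp
    qed
    then have "card {x, y} = 2" by simp
    moreover have "{x, y} \<subseteq> {x \<in> ?A. ?f x = v}" using x y yv by auto
    moreover have "finite {x \<in> ?A. ?f x = v}" by simp
    ultimately show ?thesis by (metis card_mono)
  qed
  have "2 * card (?f ` ?A) = (\<Sum>v\<in>?f ` ?A. 2)" by simp
  also have "\<dots> \<le> (\<Sum>v\<in>?f ` ?A. card {x \<in> ?A. ?f x = v})" by (intro sum_mono two)
  also have "\<dots> = card ?A" using sum.image_gen[of ?A "\<lambda>_. 1::nat" ?f] by simp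
  finally have *: "2 * card (?f ` ?A) \<le> p - 1" by simp
  have "{..<p} = insert 0 ?A" using p0 by auto
  then have "power_residues C p = insert (?f 0) (?f ` ?A)" unfolding power_residues_def by simp
  then have "card (power_residues C p) \<le> Suc (card (?f ` ?A))"
    by (simp add: card_insert_if)
  then show ?thesis using * p0 by linarith
qed

text \<open>Double counting: a fixed v in \<open>Q\<close> is moved out of \<open>Q\<close> by
  exactly p - card \<open>Q\<close> shifts.\<close>

lemma sum_escape:
  assumes "Q \<subseteq> {..<p}"
  shows "(\<Sum>j<p. escape Q p j) = card Q * (p - card Q)"
proof -
  have fin: "finite Q" by (rule finite_subset[OF assms]) simp
  have bij: "card {j \<in> {..<p}. (v + j) mod p \<notin> Q} = p - card Q" if "v \<in> Q" for v
  proof -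
    have inj: "inj_on (\<lambda>j. (v + j) mod p) {..<p}"
    proof (rule inj_onI)
      fix i j assume *: "i \<in> {..<p}" "j \<in> {..<p}" "(v + i) mod p = (v + j) mod p"
      then have "[i = j] (mod p)" by (metis cong_add_lcancel_nat cong_def)
      then show "i = j" using * by (simp add: cong_less_modulus_unique_nat)
    qed
    have im: "(\<lambda>j. (v + j) mod p) ` {..<p} = {..<p}"
      using inj by (intro card_subset_eq) (auto simp: card_image)
    let ?J = "{j \<in> {..<p}. (v + j) mod p \<notin> Q}"
    have im': "(\<lambda>j. (v + j) mod p) ` ?J = {..<p} - Q"
      using im by auto
    have "inj_on (\<lambda>j. (v + j) mod p) ?J"
      by (rule inj_on_subset[OF inj]) auto
    from card_image[OF this] have "card ?J = card ({..<p} - Q)"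
      unfolding im' by (rule sym)
    then show ?thesis using assms by (simp add: card_Diff_subset fin)
  qed
  have "(\<Sum>j<p. escape Q p j) = (\<Sum>j<p. \<Sum>v\<in>Q. if (v + j) mod p \<notin> Q then 1 else 0)"
    unfolding escape_def by (simp only: card_eq_sum sum.inter_filter[OF fin])
  also have "\<dots> = (\<Sum>v\<in>Q. \<Sum>j<p. if (v + j) mod p \<notin> Q then 1 else 0)"
    by (rule sum.swap)
  also have "\<dots> = (\<Sum>v\<in>Q. p - card Q)"
  proof (intro sum.cong refl)
    fix v assume "v \<in> Q"
    from bij[OF this] show "(\<Sum>j<p. if (v + j) mod p \<notin> Q then 1 else 0) = p - card Q"
      by (simp only: card_eq_sum sum.inter_filter[OF finite_lessThan])
  qed
  finally show ?thesis by simp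
qed

text \<open>
  The sublevel sets of \<^const>\<open>escape\<close> at the multiples of \<open>escape j\<close> are unions of cosets of
  the group of \<open>C\<close>-th powers, and adding \<open>j\<close> leads from one to the next.  Hence each of them
  contains a coset more than its predecessor, and there are at most \<open>C\<close> cosets.
\<close>

lemma escape_le_mult:
  assumes p: "prime p" and C: "C > 0" and j: "\<not> p dvd j" and x: "x < p"
  shows "escape (power_residues C p) p x \<le> C * escape (power_residues C p) p j"
proof -
  let ?Q = "power_residues C p"
  let ?N = "escape ?Q p"
  have p0: "p > 0" using p by (simp add: prime_gt_0_nat)
  have sub: "?Q \<subseteq> {..<p}" using power_residues_subset[OF p0] .
  define E where "E k = {x \<in> {..<p}. ?N x \<le> k * ?N j}" for k
  define H where "H = (\<lambda>s. s ^ C mod p) ` {0<..<p}"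
  have finE: "finite (E k)" for k unfolding E_def by simp
  have zero: "0 \<in> E k" for k
  proof -
    have e: "{v \<in> ?Q. v mod p \<notin> ?Q} = {}" using sub by auto
    have "?N 0 = card {v \<in> ?Q. v mod p \<notin> ?Q}" unfolding escape_def by simp
    also have "\<dots> = 0" by (simp only: e card.empty)
    finally have "?N 0 = 0" .
    then show ?thesis using p0 unfolding E_def by simp
  qed
  have step: "card (E (Suc k)) \<ge> card (E k) + card H" if ne: "E k \<noteq> {..<p}" for k
  proof -
    \<comment> \<open>Otherwise \<open>E k\<close> would contain 0 and be closed under adding j,
      which generates the residues modulo p.\<close>
    have "\<exists>x\<in>E k. (x + j) mod p \<notin> E k"
    proof (rule ccontr)
      assume "\<not> ?thesis"
      then have cl: "(x + j) mod p \<in> E k" if "x \<in> E k" for x using that by blast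
      have all: "(n * j) mod p \<in> E k" for n
      proof (induction n)
        case 0 then show ?case using zero by simp
      next
        case (Suc n)
        from cl[OF Suc] show ?case by (simp add: mod_simps add.commute)
      qed
      have "coprime j p" using p j by (metis coprime_commute prime_imp_coprime)
      then obtain t where t: "[j * t = 1] (mod p)" using cong_solve_coprime_nat by auto
      have "y \<in> E k" if "y < p" for y
      proof -
        have "[j * t * y = 1 * y] (mod p)" using t cong_scalar_right by blast
        then have "(t * y * j) mod p = y" using that by (simp add: cong_def mult_ac)
        then show ?thesis using all[of "t * y"] by simp
      qed
      then have "E k = {..<p}" unfolding E_def by auto
      then show False using ne by simp
    qed
    then obtain x where x: "x \<in> E k" "(x + j) mod p \<notin> E k" by blast
    define y where "y = (x + j) mod p"
    have y: "y < p" "y \<notin> E k" using x p0 unfolding y_def by auto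
    have y_nz: "y \<noteq> 0" using y(2) zero by metis
    have Ny: "?N y \<le> Suc k * ?N j"
      using escape_add[OF sub, of x j] x(1) unfolding y_def E_def by (simp add: escape_mod)
    have ny: "\<not> p dvd y" using y y_nz by (simp add: nat_dvd_not_less)
    let ?f = "\<lambda>h. (h * y) mod p"
    have cpy: "coprime y p" using p ny by (metis coprime_commute prime_imp_coprime)
    have injf: "inj_on ?f H"
    proof (rule inj_onI)
      fix h h' assume *: "h \<in> H" "h' \<in> H" "?f h = ?f h'"
      then have "[h = h'] (mod p)" using cpy cong_mult_rcancel_nat unfolding cong_def by metis
      then show "h = h'" using * unfolding H_def by (auto simp: cong_def)
    qed
    \<comment> \<open>Acting by the inverse of s too shows that \<open>escape\<close> agrees on y
      and on its whole coset. So the coset lies in \<open>E (Suc k)\<close> and is disjoint from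
      \<open>E k\<close>.\<close>
    have in1: "?f h \<in> E (Suc k) - E k" if "h \<in> H" for h
    proof -
      obtain s where s: "0 < s" "s < p" "h = s ^ C mod p" using \<open>h \<in> H\<close> unfolding H_def by auto
      have ns: "\<not> p dvd s" using s by (simp add: nat_dvd_not_less)
      have "coprime s p" using p ns by (metis coprime_commute prime_imp_coprime)
      then obtain t where t: "[s * t = 1] (mod p)" using cong_solve_coprime_nat by auto
      have nt: "\<not> p dvd t"
      proof
        assume "p dvd t"
        then have "p dvd s * t" by simp
        then have "p dvd 1" using t cong_dvd_iff by blast
        then show False using p by simp
      qed
      have fh: "?f h = (s ^ C * y) mod p" unfolding s by (simp add: mod_simps)
      have N1: "?N (?f h) \<le> ?N y" unfolding fh escape_mod using escape_mult_power_le[OF p ns] .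
      have "[t ^ C * (s ^ C * y) = 1 * y] (mod p)"
        using cong_scalar_right[OF cong_pow[OF t, of C], of y] by (simp add: power_mult_distrib mult_ac)
      then have "(t ^ C * (s ^ C * y)) mod p = y mod p" by (simp add: cong_def)
      then have "?N y \<le> ?N (s ^ C * y)"
        using escape_mult_power_le[OF p nt, of C "s ^ C * y"] escape_mod[of ?Q p] by metis
      then have N2: "?N y \<le> ?N (?f h)" unfolding fh escape_mod .
      have "?f h \<notin> E k" using N2 y unfolding E_def by simp
      moreover have "?f h \<in> E (Suc k)" using N1 Ny p0 unfolding E_def by auto
      ultimately show ?thesis by simp
    qed
    have sub2: "E k \<union> ?f ` H \<subseteq> E (Suc k)"
      using in1 unfolding E_def by auto
    have "card (E k) + card H = card (E k) + card (?f ` H)" using injf by (simp add: card_image)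
    also have "\<dots> = card (E k \<union> ?f ` H)"
      using in1 by (intro card_Un_disjoint[symmetric] finE) (auto simp: H_def)
    also have "\<dots> \<le> card (E (Suc k))" by (intro card_mono finE sub2)
    finally show ?thesis .
  qed
  have mono: "E k \<subseteq> E (Suc k)" for k unfolding E_def by auto
  \<comment> \<open>The summand 1 stands for the element 0. As there are at least (p - 1) / C
    nonzero powers, stage C reaches all p residues.\<close>
  have grow: "E k = {..<p} \<or> card (E k) \<ge> 1 + k * card H" for k
  proof (induction k)
    case 0
    then show ?case using zero finE[of 0] by (auto simp: Suc_le_eq card_gt_0_iff)
  next
    case (Suc k)
    show ?case
    proof (cases "E k = {..<p}")
      case True
      then show ?thesis using mono[of k] unfolding E_def by blast
    next
      case False
      then show ?thesis using Suc step[of k] by simp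
    qed
  qed
  have "E C = {..<p}"
  proof (rule ccontr)
    assume ne: "E C \<noteq> {..<p}"
    then have "card (E C) \<ge> 1 + C * card H" using grow by blast
    then have "card (E C) \<ge> p"
      using card_power_residues(2)[OF p C] unfolding H_def by linarith
    moreover have "E C \<subset> {..<p}" using ne unfolding E_def by blast
    then have "card (E C) < p" using psubset_card_mono[of "{..<p}" "E C"] by simp
    ultimately show False by simp
  qed
  then show ?thesis using x unfolding E_def by auto
qed

text \<open>With q power residues, the mean of \<open>escape\<close> over all shifts is q (p - q) /
  p. Here q is at least p / C, and p - q is at least (p - 1) / 2, hence at least p / 4. By
  \<open>escape_le_mult\<close> no nonzero shift falls below 1 / C of the mean, and every escaping
  residue is the power of some t; this gives the proportion 1 / (4 C^2).\<close>

lemma card_shifted_power_le: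
  assumes p: "prime p" and C: "C > 0" and j: "\<not> p dvd j"
    and z: "[z ^ C = 1] (mod p)" "\<not> [z = 1] (mod p)"
  shows "real (card {t \<in> {..<p}. \<exists>s. [s ^ C = t ^ C + j] (mod p)}) \<le> (1 - 1 / (4 * real C ^ 2)) * real p"
proof -
  let ?Q = "power_residues C p"
  let ?N = "escape ?Q p"
  have p0: "p > 0" and p2: "p \<ge> 2" using p by (auto simp: prime_gt_0_nat prime_ge_2_nat)
  have sub: "?Q \<subseteq> {..<p}" using power_residues_subset[OF p0] .
  have "card ?Q * (p - card ?Q) = (\<Sum>x<p. ?N x)" using sum_escape[OF sub] by simp
  also have "\<dots> \<le> (\<Sum>x<p. C * ?N j)" using escape_le_mult[OF p C j] by (intro sum_mono) auto
  finally have 1: "card ?Q * (p - card ?Q) \<le> p * (C * ?N j)" by simp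
  have 2: "p \<le> C * card ?Q" by (rule card_power_residues[OF p C])
  have 3: "2 * card ?Q \<le> p + 1" by (rule card_power_residues_upper[OF p z C])
  have "p * (p - card ?Q) \<le> C * (card ?Q * (p - card ?Q))" using 2 by (metis mult.assoc mult_le_mono1)
  also have "\<dots> \<le> C * (p * (C * ?N j))" using 1 by simp
  finally have "p * (p - card ?Q) \<le> p * (C * (C * ?N j))" by (simp add: mult_ac)
  then have 4: "p - card ?Q \<le> C * (C * ?N j)" using p0 by simp
  have "4 * (p - card ?Q) \<ge> p" using 3 p2 by linarith
  then have "p \<le> 4 * (C * (C * ?N j))" using 4 by linarith
  then have "real p \<le> real (4 * (C * (C * ?N j)))" by (rule of_nat_mono)
  then have 5: "real p \<le> 4 * real C ^ 2 * real (?N j)" by (simp add: power2_eq_square mult_ac)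
  have ge: "?N j \<le> card {t \<in> {..<p}. (t ^ C + j) mod p \<notin> ?Q}"
  proof -
    have "{v \<in> ?Q. (v + j) mod p \<notin> ?Q} \<subseteq> (\<lambda>x. x ^ C mod p) ` {t \<in> {..<p}. (t ^ C + j) mod p \<notin> ?Q}"
      unfolding power_residues_def by (auto simp: mod_simps)
    moreover have fin: "finite {t \<in> {..<p}. (t ^ C + j) mod p \<notin> ?Q}" by simp
    ultimately show ?thesis unfolding escape_def
      by (meson card_image_le card_mono finite_imageI le_trans)
  qed
  have "{t \<in> {..<p}. \<exists>s. [s ^ C = t ^ C + j] (mod p)} \<subseteq> {..<p} - {t \<in> {..<p}. (t ^ C + j) mod p \<notin> ?Q}"
  proof -
    have "(t ^ C + j) mod p \<in> ?Q" if "[s ^ C = t ^ C + j] (mod p)" for s t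
      using mem_power_residuesI[OF p0, of s C] that unfolding cong_def by simp
    then show ?thesis by blast
  qed
  then have "card {t \<in> {..<p}. \<exists>s. [s ^ C = t ^ C + j] (mod p)} \<le> card ({..<p} - {t \<in> {..<p}. (t ^ C + j) mod p \<notin> ?Q})"
    by (intro card_mono) auto
  also have "\<dots> = p - card {t \<in> {..<p}. (t ^ C + j) mod p \<notin> ?Q}"
    by (subst card_Diff_subset) auto
  also have "\<dots> \<le> p - ?N j" using ge by simp
  finally have "real (card {t \<in> {..<p}. \<exists>s. [s ^ C = t ^ C + j] (mod p)}) \<le> real (p - ?N j)"
    by (rule of_nat_mono)
  also have "\<dots> = real p - real (?N j)"
  proof -
    have "?N j \<le> card ?Q" unfolding escape_def by (intro card_mono) auto
    then show ?thesis using card_mono[OF _ sub] by simp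
  qed
  also have "\<dots> \<le> real p - real p / (4 * real C ^ 2)" using 5 C by (simp add: field_simps)
  finally show ?thesis by (simp add: algebra_simps)
qed

section \<open>Squarefree moduli with isolated power residues\<close>

lemma card_residues_prod_le:
  fixes Ps :: "nat set"
  assumes "finite Ps" "\<And>p. p \<in> Ps \<Longrightarrow> prime p" "\<And>p. p \<in> Ps \<Longrightarrow> B p \<subseteq> {..<p}"
  shows "card {t \<in> {..<\<Prod>Ps}. \<forall>p\<in>Ps. t mod p \<in> B p} \<le> (\<Prod>p\<in>Ps. card (B p))"
proof -
  let ?A = "{t \<in> {..<\<Prod>Ps}. \<forall>p\<in>Ps. t mod p \<in> B p}"
  let ?f = "\<lambda>t. \<lambda>p\<in>Ps. t mod p"
  have finB: "finite (B p)" if "p \<in> Ps" for p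
    by (rule finite_subset[OF assms(3)[OF that]]) simp
  \<comment> \<open>The Chinese remainder map serves as an injection, which is all that an upper
    bound asks for.\<close>
  have "inj_on ?f ?A"
  proof (rule inj_onI)
    fix t u assume *: "t \<in> ?A" "u \<in> ?A" "?f t = ?f u"
    have "[t = u] (mod p)" if "p \<in> Ps" for p
      using fun_cong[OF *(3), of p] that by (simp add: cong_def)
    then have "[t = u] (mod (\<Prod>i\<in>Ps. i))"
      by (intro coprime_cong_prod_nat) (auto intro: primes_coprime assms(2))
    then show "t = u" using * by (auto intro: cong_less_modulus_unique_nat)
  qed
  moreover have "?f ` ?A \<subseteq> PiE Ps B" by auto
  moreover have "finite (PiE Ps B)" using assms(1) finB by (intro finite_PiE) auto
  ultimately have "card ?A \<le> card (PiE Ps B)" by (rule card_inj_on_le)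
  then show ?thesis unfolding card_PiE[OF assms(1)] .
qed

lemma infinite_primes_nontrivial_root_of_unity:
  assumes "C \<ge> (2::nat)"
  shows "infinite {p::nat. prime p \<and> p > N \<and> (\<exists>z. [z ^ C = 1] (mod p) \<and> \<not> [z = 1] (mod p))}"
  unfolding infinite_nat_iff_unbounded
proof
  fix m
  obtain p z where "prime p" "p > N + m" "[z ^ C = 1] (mod p)" "\<not> [z = (1::nat)] (mod p)"
    using ex_prime_nontrivial_root_of_unity[OF assms, of "N + m"] by blast
  then show "\<exists>n>m. n \<in> {p. prime p \<and> p > N \<and> (\<exists>z. [z ^ C = 1] (mod p) \<and> \<not> [z = 1] (mod p))}"
    by (intro exI[of _ p]) auto
qed

text \<open>The alternatives are the neighbours x + j and x - j, the latter written without
  subtraction of naturals. The value j = 0 is excluded because x itself may be a power.\<close>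

definition near_power_residue :: "nat \<Rightarrow> nat \<Rightarrow> nat \<Rightarrow> nat \<Rightarrow> bool" where
  "near_power_residue C r L x \<longleftrightarrow>
     (\<exists>s j. 0 < j \<and> j \<le> L \<and> ([s ^ C = x + j] (mod r) \<or> [x = s ^ C + j] (mod r)))"

text \<open>By \<open>card_shifted_power_le\<close> and the Chinese remainder theorem, a given shift
  is bad for a proportion at most d ^ w of all t, with d < 1 depending on C only. There are 2 * L
  shifts, so L and C determine w before any prime is selected.\<close>

lemma ex_modulus_isolated_power_residues:
  fixes C L N :: nat and h2 :: "nat \<Rightarrow> real"
  assumes C: "C \<ge> 2" and h2: "filterlim h2 at_top sequentially"
  shows "\<exists>r>N. squarefree r \<and> (\<forall>p. prime p \<and> p dvd r \<longrightarrow> p > N) \<and>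
     real (num_prime_divisors r) < h2 r \<and>
     real (card {t \<in> {1..r}. t = r \<or> near_power_residue C r L (t ^ C)}) < real r / 4"
proof -
  define d where "d = 1 - 1 / (4 * real C ^ 2)"
  have d: "0 \<le> d" "d < 1" using C unfolding d_def by (auto simp: field_simps power2_eq_square) 
      (use mult_mono[of 2 "real C" 2 "real C"] in simp)
  have "(\<lambda>n. 2 * real L * d ^ n) \<longlonglongrightarrow> 2 * real L * 0"
    by (intro tendsto_mult tendsto_const LIMSEQ_realpow_zero d)
  then have "eventually (\<lambda>n. 2 * real L * d ^ n < 1 / 8) sequentially"
    by (rule order_tendstoD) simp
  then have "eventually (\<lambda>n. 2 * real L * d ^ n < 1 / 8 \<and> n \<ge> 1) sequentially"
    using eventually_ge_at_top by (rule eventually_conj)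
  then obtain w where w: "2 * real L * d ^ w < 1 / 8" "w \<ge> 1"
    using eventually_happens trivial_limit_sequentially by blast
  have "eventually (\<lambda>n. h2 n > real w) sequentially"
    using h2 by (simp add: filterlim_at_top_dense)
  then obtain N0 where N0: "\<And>n. n \<ge> N0 \<Longrightarrow> h2 n > real w"
    by (auto simp: eventually_sequentially)
  \<comment> \<open>Each summand serves one estimate: \<open>N\<close> is the required bound on
    prime factors, \<open>L\<close> makes every shift j \<le> L nonzero modulo every chosen prime,
    \<open>N0\<close> gives h2 r > w, and 8 makes the single index t = r cost less than r /
    8.\<close>
  define N1 where "N1 = N + L + N0 + 8"
  define G where "G = {p::nat. prime p \<and> p > N1 \<and> (\<exists>z. [z ^ C = 1] (mod p) \<and> \<not> [z = 1] (mod p))}"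
  have "infinite G" unfolding G_def by (rule infinite_primes_nontrivial_root_of_unity[OF C])
  then obtain Ps where Ps: "finite Ps" "card Ps = w" "Ps \<subseteq> G"
    using infinite_arbitrarily_large by blast
  have pr: "prime p" and big: "p > N1" if "p \<in> Ps" for p using Ps(3) that unfolding G_def by auto
  define r where "r = \<Prod>Ps"
  have r0: "r > 0" unfolding r_def using pr by (intro prod_pos) (auto simp: prime_gt_0_nat)
  have dvd_iff: "prime p \<and> p dvd r \<longleftrightarrow> p \<in> Ps" for p
  proof
    assume *: "prime p \<and> p dvd r"
    then obtain q where "q \<in> Ps" "p dvd q" unfolding r_def using Ps(1) by (auto simp: prime_dvd_prod_iff)
    then show "p \<in> Ps" using * pr by (metis primes_dvd_imp_eq)
  next
    assume "p \<in> Ps"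
    then show "prime p \<and> p dvd r" unfolding r_def using Ps(1) pr by (auto intro: dvd_prodI)
  qed
  obtain p0 where p0: "p0 \<in> Ps" using w(2) Ps(2) by (cases "Ps = {}") auto
  have rbig: "r > N1"
  proof -
    have "p0 dvd r" using p0 dvd_iff by blast
    then have "p0 \<le> r" using r0 by (rule dvd_imp_le)
    then show ?thesis using big[OF p0] by simp
  qed
  have sqf: "squarefree r" unfolding r_def
  proof (rule squarefree_prod_coprime)
    show "coprime a b" if "a \<in> Ps" "b \<in> Ps" "a \<noteq> b" for a b
      using primes_coprime[OF pr[OF that(1)] pr[OF that(2)] that(3)] .
    show "squarefree a" if "a \<in> Ps" for a using pr[OF that] by (rule squarefree_prime)
  qed
  have om: "num_prime_divisors r = w" unfolding num_prime_divisors_def dvd_iff using Ps(2) by simp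
  have count: "real (card {t \<in> {..<r}. \<exists>s. [s ^ C = t ^ C + j] (mod r)}) \<le> d ^ w * real r"
    if j: "\<And>p. p \<in> Ps \<Longrightarrow> \<not> p dvd j" for j
  proof -
    define B where "B p = {t \<in> {..<p}. \<exists>s. [s ^ C = t ^ C + j] (mod p)}" for p
    have "{t \<in> {..<r}. \<exists>s. [s ^ C = t ^ C + j] (mod r)} \<subseteq> {t \<in> {..<\<Prod>Ps}. \<forall>p\<in>Ps. t mod p \<in> B p}"
    proof (rule subsetI, elim CollectE conjE exE)
      fix t s assume t: "t \<in> {..<r}" "[s ^ C = t ^ C + j] (mod r)"
      have "t mod p \<in> B p" if "p \<in> Ps" for p
      proof -
        have "p dvd r" "prime p" using that dvd_iff by blast+
        then have "[s ^ C = t ^ C + j] (mod p)" using t(2) cong_dvd_modulus_nat by blast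
        moreover have "[t ^ C + j = (t mod p) ^ C + j] (mod p)"
          by (intro cong_add cong_refl cong_pow) (simp add: cong_def)
        ultimately have "[s ^ C = (t mod p) ^ C + j] (mod p)" by (rule cong_trans)
        then show ?thesis using prime_gt_0_nat[OF \<open>prime p\<close>] unfolding B_def by auto
      qed
      then show "t \<in> {t \<in> {..<\<Prod>Ps}. \<forall>p\<in>Ps. t mod p \<in> B p}" using t(1) unfolding r_def by simp
    qed
    then have "card {t \<in> {..<r}. \<exists>s. [s ^ C = t ^ C + j] (mod r)} \<le> card {t \<in> {..<\<Prod>Ps}. \<forall>p\<in>Ps. t mod p \<in> B p}"
      by (intro card_mono) auto
    also have "\<dots> \<le> (\<Prod>p\<in>Ps. card (B p))"
      by (rule card_residues_prod_le[OF Ps(1) pr]) (auto simp: B_def)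
    finally have le: "card {t \<in> {..<r}. \<exists>s. [s ^ C = t ^ C + j] (mod r)} \<le> (\<Prod>p\<in>Ps. card (B p))" .
    have "real (card {t \<in> {..<r}. \<exists>s. [s ^ C = t ^ C + j] (mod r)}) \<le> (\<Prod>p\<in>Ps. real (card (B p)))"
      using of_nat_mono[OF le, where 'a = real] by (simp only: of_nat_prod)
    also have "\<dots> \<le> (\<Prod>p\<in>Ps. d * real p)"
    proof (intro prod_mono conjI)
      fix p assume p: "p \<in> Ps"
      then obtain z where z: "[z ^ C = 1] (mod p)" "\<not> [z = 1] (mod p)" using Ps(3) unfolding G_def by auto
      show "real (card (B p)) \<le> d * real p" unfolding B_def d_def
        using card_shifted_power_le[OF pr[OF p] _ j[OF p] z] C by simp
    qed simp
    also have "\<dots> = d ^ w * real r" unfolding r_def Ps(2)[symmetric] by (simp add: prod.distrib)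
    finally show ?thesis .
  qed
  define S where "S j = {t \<in> {..<r}. \<exists>s. [s ^ C = t ^ C + j] (mod r)}" for j
  have finS: "finite (S j)" for j unfolding S_def by simp
  let ?bad = "{t \<in> {1..r}. t = r \<or> near_power_residue C r L (t ^ C)}"
  \<comment> \<open>A shift by -j is expressed as the shift j * (r - 1), congruent to it modulo r,
    so that the estimate \<open>count\<close> covers both sides.\<close>
  have "?bad \<subseteq> {r} \<union> (\<Union>j\<in>{1..L}. S j \<union> S (j * (r - 1)))"
  proof (rule subsetI, rule ccontr)
    fix t assume bt: "t \<in> ?bad" and nt: "t \<notin> {r} \<union> (\<Union>j\<in>{1..L}. S j \<union> S (j * (r - 1)))"
    then obtain s j where j: "0 < j" "j \<le> L"
      and h: "[s ^ C = t ^ C + j] (mod r) \<or> [t ^ C = s ^ C + j] (mod r)"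
      unfolding near_power_residue_def by auto
    have t: "t < r" using bt nt by auto
    have no: "t \<notin> S j" "t \<notin> S (j * (r - 1))" using nt j by auto
    from h show False
    proof
      assume "[s ^ C = t ^ C + j] (mod r)"
      then have "t \<in> S j" using t unfolding S_def by auto
      then show False using no by simp
    next
      assume *: "[t ^ C = s ^ C + j] (mod r)"
      have "[t ^ C + j * (r - 1) = s ^ C + j + j * (r - 1)] (mod r)"
        using * by (simp add: cong_add_rcancel_nat)
      also have "s ^ C + j + j * (r - 1) = s ^ C + j * r"
        using r0 by (cases r) (auto simp: algebra_simps)
      also have "[s ^ C + j * r = s ^ C] (mod r)" by (simp add: cong_def)
      finally have "t \<in> S (j * (r - 1))" using t unfolding S_def by (auto intro: cong_sym)
      then show False using no by simp
    qed
  qed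
  then have "card ?bad \<le> card ({r} \<union> (\<Union>j\<in>{1..L}. S j \<union> S (j * (r - 1))))"
    by (intro card_mono) (auto simp: finS)
  also have "\<dots> \<le> card {r} + card (\<Union>j\<in>{1..L}. S j \<union> S (j * (r - 1)))" by (rule card_Un_le)
  also have "\<dots> \<le> 1 + (\<Sum>j\<in>{1..L}. card (S j \<union> S (j * (r - 1))))"
    using card_UN_le[of "{1..L}" "\<lambda>j. S j \<union> S (j * (r - 1))"] by simp
  also have "\<dots> \<le> 1 + (\<Sum>j\<in>{1..L}. card (S j) + card (S (j * (r - 1))))"
    by (intro add_left_mono sum_mono card_Un_le)
  finally have "real (card ?bad) \<le> real (1 + (\<Sum>j\<in>{1..L}. card (S j) + card (S (j * (r - 1)))))"
    by (rule of_nat_mono)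
  also have "\<dots> = 1 + (\<Sum>j\<in>{1..L}. real (card (S j)) + real (card (S (j * (r - 1)))))"
    by simp
  also have "\<dots> \<le> 1 + (\<Sum>j\<in>{1..L}. d ^ w * real r + d ^ w * real r)"
  proof (intro add_left_mono sum_mono add_mono)
    fix j assume "j \<in> {1..L}"
    then have j: "\<not> p dvd j" if "p \<in> Ps" for p
      using big[OF that] by (auto simp: N1_def nat_dvd_not_less)
    then show "real (card (S j)) \<le> d ^ w * real r" unfolding S_def by (intro count)
    have "\<not> p dvd j * (r - 1)" if p: "p \<in> Ps" for p
    proof
      assume "p dvd j * (r - 1)"
      then have "p dvd r - 1" using prime_dvd_mult_iff[OF pr[OF p]] j[OF p] by blast
      moreover have "p dvd r" using p dvd_iff by blast
      ultimately have "p dvd r - (r - 1)" by (rule dvd_diff_nat[rotated])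
      moreover have "r - (r - 1) = 1" using r0 by simp
      ultimately have "p dvd 1" by simp
      then show False using pr[OF p] by simp
    qed
    then show "real (card (S (j * (r - 1)))) \<le> d ^ w * real r" unfolding S_def by (intro count)
  qed
  also have "\<dots> = 1 + (2 * real L * d ^ w) * real r" by simp
  also have "\<dots> < real r / 8 + (1 / 8) * real r"
  proof (intro add_less_le_mono mult_right_mono)
    show "1 < real r / 8" using rbig unfolding N1_def by simp
  qed (use w(1) in auto)
  finally have bad: "real (card ?bad) < real r / 4" by simp
  show ?thesis
  proof (intro exI[of _ r] conjI allI impI)
    show "r > N" using rbig unfolding N1_def by simp
    show "squarefree r" by (rule sqf)
    show "p > N" if "prime p \<and> p dvd r" for p using big[of p] that dvd_iff[of p] unfolding N1_def by auto
    show "real (num_prime_divisors r) < h2 r" unfolding om using rbig by (intro N0) (simp add: N1_def)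
  qed (rule bad)
qed

section \<open>Skew products over circle rotations\<close>

lemma cmod_cis_diff_le: "cmod (cis x - cis y) \<le> \<bar>x - y\<bar>"
proof -
  have "cis x - cis y = cis y * (cis (x - y) - 1)"
    by (simp add: algebra_simps cis_mult)
  then have "cmod (cis x - cis y) = cmod (cis (x - y) - 1)"
    by (simp add: norm_mult)
  also have "\<dots> \<le> \<bar>x - y\<bar>"
    using iexp_approx1[of "x - y" 0] by (simp add: cis_conv_exp)
  finally show ?thesis .
qed

text \<open>The n-th roots of \<open>\<beta>\<close> are 2 * pi / n apart in angle. The bound
  \<open>n0\<close> depends on \<open>\<epsilon>\<close> alone, which permits fixing n before the
  points.\<close>

lemma ex_near_root_on_circle:
  assumes "\<epsilon> > 0"
  shows "\<exists>n0. \<forall>n\<ge>n0. \<forall>a \<beta>. cmod a = 1 \<longrightarrow> cmod \<beta> = 1 \<longrightarrow>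
     (\<exists>a'. cmod a' = 1 \<and> cmod (a' - a) < \<epsilon> \<and> a' ^ n = \<beta>)"
proof -
  obtain n0 :: nat where n0: "2 * pi / \<epsilon> < real n0" using reals_Archimedean2 by blast
  show ?thesis
  proof (intro exI[of _ n0] allI impI)
    fix n a \<beta> assume n: "n \<ge> n0" and a: "cmod a = 1" and b: "cmod \<beta> = 1"
    have npos: "real n > 0"
    proof -
      have "0 \<le> 2 * pi / \<epsilon>" using assms by simp
      then show ?thesis using n0 n by linarith
    qed
    obtain x where x: "a = cis x" using a by (metis zero_neq_one norm_zero cis_Arg sgn_eq div_by_1 of_real_1)
    obtain y where y: "\<beta> = cis y" using b by (metis zero_neq_one norm_zero cis_Arg sgn_eq div_by_1 of_real_1)
    define k where "k = \<lfloor>(real n * x - y) / (2 * pi)\<rfloor>"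
    define x' where "x' = (y + 2 * pi * of_int k) / real n"
    have k1: "of_int k \<le> (real n * x - y) / (2 * pi)" and k2: "(real n * x - y) / (2 * pi) < of_int k + 1"
      unfolding k_def by linarith+
    have k1': "2 * pi * of_int k \<le> real n * x - y"
      using k1 pi_gt_zero by (simp add: pos_le_divide_eq mult.commute)
    have k2': "real n * x - y < 2 * pi * of_int k + 2 * pi"
      using k2 pi_gt_zero by (simp add: pos_divide_less_eq algebra_simps)
    have nx: "real n * x' = y + 2 * pi * of_int k" unfolding x'_def using npos by simp
    have "real n * \<bar>x' - x\<bar> = \<bar>real n * x' - real n * x\<bar>"
      using npos by (simp add: abs_mult right_diff_distrib[symmetric])
    also have "\<dots> \<le> 2 * pi" using nx k1' k2' by linarith
    finally have "\<bar>x' - x\<bar> \<le> 2 * pi / real n" using npos by (simp add: pos_le_divide_eq mult.commute)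
    also have "\<dots> < \<epsilon>"
    proof -
      have "2 * pi / \<epsilon> < real n" using n0 n by linarith
      then show ?thesis using assms npos by (simp add: field_simps)
    qed
    finally have "cmod (cis x' - a) < \<epsilon>" using cmod_cis_diff_le[of x' x] x by simp
    moreover have "cis x' ^ n = \<beta>"
    proof -
      have "cis x' ^ n = cis (real n * x')" by (rule Complex.DeMoivre)
      also have "\<dots> = cis y * cis (2 * pi * of_int k)" unfolding nx by (simp only: cis_mult)
      finally show ?thesis using y cis_multiple_2pi[of "of_int k"] by simp
    qed
    ultimately show "\<exists>a'. cmod a' = 1 \<and> cmod (a' - a) < \<epsilon> \<and> a' ^ n = \<beta>"
      by (intro exI[of _ "cis x'"]) simp
  qed
qed

lemma continuous_on_bcontfun_apply:
  fixes f :: "'a::topological_space \<Rightarrow> 'b::t2_space \<Rightarrow>\<^sub>C 'c::metric_space"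
  assumes "continuous_on S f" "continuous_on S h"
  shows "continuous_on S (\<lambda>x. apply_bcontfun (f x) (h x))"
  unfolding continuous_on_def
proof
  fix x assume x: "x \<in> S"
  have f: "(f \<longlongrightarrow> f x) (at x within S)" and h: "(h \<longlongrightarrow> h x) (at x within S)"
    using assms x by (auto simp: continuous_on_def)
  have "isCont (apply_bcontfun (f x)) (h x)"
    using continuous_on_eq_continuous_at[OF open_UNIV] continuous_on_apply_bcontfun by blast
  then have g: "((\<lambda>y. apply_bcontfun (f x) (h y)) \<longlongrightarrow> apply_bcontfun (f x) (h x)) (at x within S)"
    using h by (rule isCont_tendsto_compose)
  have up: "((\<lambda>y. dist (f y) (f x) + dist (apply_bcontfun (f x) (h y)) (apply_bcontfun (f x) (h x))) \<longlongrightarrow> 0) (at x within S)"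
    using tendsto_add[OF tendsto_dist_iff[THEN iffD1, OF f] tendsto_dist_iff[THEN iffD1, OF g]] by simp
  have "dist (apply_bcontfun (f y) (h y)) (apply_bcontfun (f x) (h x))
        \<le> dist (f y) (f x) + dist (apply_bcontfun (f x) (h y)) (apply_bcontfun (f x) (h x))" for y
    using dist_triangle[of "apply_bcontfun (f y) (h y)" "apply_bcontfun (f x) (h x)" "apply_bcontfun (f x) (h y)"]
      dist_bounded[of "f y" "h y" "f x"] by linarith
  then have "((\<lambda>y. dist (apply_bcontfun (f y) (h y)) (apply_bcontfun (f x) (h x))) \<longlongrightarrow> 0) (at x within S)"
    by (intro Lim_null_comparison[OF always_eventually up]) simp
  then show "((\<lambda>x. apply_bcontfun (f x) (h x)) \<longlongrightarrow> apply_bcontfun (f x) (h x)) (at x within S)"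
    by (rule tendsto_dist_iff[THEN iffD2])
qed

text \<open>The closure is a closed part of a complete space, so Baire's theorem applies there.
  Density is tested at points of A by points of A, because only those will have an explicit
  form.\<close>

lemma Baire_closure:
  fixes A :: "'a::complete_space set"
  assumes "countable \<U>" "A \<noteq> {}" and op: "\<And>U. U \<in> \<U> \<Longrightarrow> open U"
    and dense: "\<And>U p e. U \<in> \<U> \<Longrightarrow> p \<in> A \<Longrightarrow> e > 0 \<Longrightarrow> \<exists>q\<in>A \<inter> U. dist q p < e"
  shows "\<exists>p\<in>closure A. \<forall>U\<in>\<U>. p \<in> U"
proof -
  let ?X = "top_of_set (closure A)"
  let ?G = "insert (closure A) ((\<lambda>U. closure A \<inter> U) ` \<U>)"
  have dns: "closure A \<subseteq> closure (closure A \<inter> U)" if U: "U \<in> \<U>" for U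
  proof -
    have "A \<subseteq> closure (closure A \<inter> U)"
    proof
      fix p assume p: "p \<in> A"
      show "p \<in> closure (closure A \<inter> U)"
        unfolding closure_approachable
      proof (intro allI impI)
        fix e :: real assume "e > 0"
        then obtain q where "q \<in> A \<inter> U" "dist q p < e" using dense[OF U p] by blast
        then show "\<exists>y\<in>closure A \<inter> U. dist y p < e" using closure_subset by blast
      qed
    qed
    then show ?thesis by (simp add: closure_minimal)
  qed
  have "?X closure_of \<Inter>?G = topspace ?X"
  proof (rule Baire_category)
    show "completely_metrizable_space ?X \<or> locally_compact_space ?X \<and> regular_space ?X"
      by (intro disjI1 completely_metrizable_space_closedin completely_metrizable_space_euclidean) simp
    show "countable ?G" using assms(1) by simp
    show "openin ?X T \<and> ?X closure_of T = topspace ?X" if T: "T \<in> ?G" for T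
    proof (cases "T = closure A")
      case True
      then show ?thesis by (simp add: closure_of_subtopology)
    next
      case False
      then obtain U where U: "U \<in> \<U>" "T = closure A \<inter> U" using T by auto
      have "openin ?X T" using op[OF U(1)] U(2) by (auto simp: openin_open)
      moreover have "?X closure_of T = closure A"
        using dns[OF U(1)] U(2) by (auto simp: closure_of_subtopology Int_absorb1)
      ultimately show ?thesis by simp
    qed
  qed
  then have "?X closure_of \<Inter>?G = closure A" by simp
  moreover have "closure A \<noteq> {}" using assms(2) by simp
  ultimately have "\<Inter>?G \<noteq> {}" by (metis closure_of_empty)
  then obtain p where p: "p \<in> \<Inter>?G" by blast
  then have "p \<in> closure A" by blast
  moreover have "p \<in> U" if "U \<in> \<U>" for U
    using p that by blast
  ultimately show ?thesis by blast
qed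

section \<open>The parameter space of skew products\<close>

abbreviation torus :: "(complex \<times> complex) set" where
  "torus \<equiv> sphere 0 1 \<times> sphere 0 1"

text \<open>The parameter is the multiplier of the base rotation together with the cocycle. Taking
  the cocycle in \<open>complex \<Rightarrow>\<^sub>C complex\<close>, with the uniform distance,
  makes the parameters a complete space.\<close>

definition skew :: "complex \<times> (complex \<Rightarrow>\<^sub>C complex) \<Rightarrow> complex \<times> complex \<Rightarrow> complex \<times> complex" where
  "skew p x = (fst p * fst x, snd x * apply_bcontfun (snd p) (fst x))"

text \<open>Continuity is joint in the map and the point; the openness of conditions on iterates
  rests on this.\<close>

lemma continuous_on_skew_funpow:
  assumes "continuous_on S f" "continuous_on S g"
  shows "continuous_on S (\<lambda>x. (skew (f x) ^^ n) (g x))"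
proof (induction n)
  case 0
  then show ?case using assms by simp
next
  case (Suc n)
  then show ?case unfolding funpow.simps o_def
    by (subst skew_def) (intro continuous_intros continuous_on_bcontfun_apply assms)
qed

lemma fst_skew_funpow [simp]: "fst ((skew p ^^ n) x) = fst p ^ n * fst x"
  by (induction n) (auto simp: skew_def)

text \<open>
  Functions on the circle are represented by functions on the whole plane; the vanishing condition
  makes them uniformly continuous.
\<close>

definition admissible :: "(complex \<Rightarrow> real) \<Rightarrow> bool" where
  "admissible G \<longleftrightarrow> continuous_on UNIV G \<and> (\<forall>z. cmod z \<ge> 2 \<longrightarrow> G z = 0)"

text \<open>
  For unimodular \<open>a\<close> and \<open>b\<close>, the map \<open>skew (cob a b G)\<close> is the conjugate of the rotation
  \<open>(z, w) \<mapsto> (a z, b w)\<close> by the homeomorphism \<open>(z, w) \<mapsto> (z, w cis (G z))\<close>.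
\<close>

definition cob :: "complex \<Rightarrow> complex \<Rightarrow> (complex \<Rightarrow> real) \<Rightarrow> complex \<times> (complex \<Rightarrow>\<^sub>C complex)" where
  "cob a b G = (a, Bcontfun (\<lambda>z. b * cis (G (a * z) - G z)))"

definition coboundaries :: "(complex \<times> (complex \<Rightarrow>\<^sub>C complex)) set" where
  "coboundaries = {cob a b G | a b G. cmod a = 1 \<and> cmod b = 1 \<and> admissible G}"

lemma fst_cob [simp]: "fst (cob a b G) = a"
  by (simp add: cob_def)

lemma apply_cob:
  assumes "admissible G"
  shows "apply_bcontfun (snd (cob a b G)) z = b * cis (G (a * z) - G z)"
proof -
  have G: "continuous_on UNIV G" using assms by (simp add: admissible_def)
  have "continuous_on UNIV (\<lambda>z. G (a * z))"
    by (rule continuous_on_compose2[OF G]) (auto intro!: continuous_intros)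
  then have "continuous_on UNIV (\<lambda>z. b * cis (G (a * z) - G z))"
    using G unfolding cis_conv_exp by (intro continuous_intros)
  moreover have "norm (b * cis (G (a * z) - G z)) \<le> cmod b" for z by (simp add: norm_mult)
  ultimately have "(\<lambda>z. b * cis (G (a * z) - G z)) \<in> bcontfun" by (rule bcontfun_normI)
  then show ?thesis by (simp add: cob_def Bcontfun_inverse)
qed

text \<open>The phase differences along an orbit telescope. In particular, if a ^ n = 1, the n-th
  iterate is exactly the vertical rotation by b ^ n, whatever G is.\<close>

lemma skew_funpow_cob:
  assumes "admissible G"
  shows "(skew (cob a b G) ^^ n) (z, w) = (a ^ n * z, w * b ^ n * cis (G (a ^ n * z) - G z))"
proof (induction n)
  case (Suc n)
  have "cis (G (a ^ n * z) - G z) * cis (G (a * (a ^ n * z)) - G (a ^ n * z)) = cis (G (a * (a ^ n * z)) - G z)"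
    by (simp add: cis_mult)
  then show ?case using Suc by (simp add: skew_def apply_cob[OF assms] mult_ac)
qed simp

lemma admissible_add: "admissible G \<Longrightarrow> admissible K \<Longrightarrow> admissible (\<lambda>z. G z + K z)"
  unfolding admissible_def by (auto intro: continuous_intros)

lemma admissible_zero: "admissible (\<lambda>z. 0)"
  unfolding admissible_def by auto

lemma cob_in_coboundaries: "cmod a = 1 \<Longrightarrow> cmod b = 1 \<Longrightarrow> admissible G \<Longrightarrow> cob a b G \<in> coboundaries"
  unfolding coboundaries_def by blast

text \<open>K enters only through its increments along the rotation by a', so K itself may be large.
  This allows big phase changes at distant times within a small perturbation.\<close>

lemma dist_cob_small:
  assumes G: "admissible G" and e: "e > 0"
  shows "\<exists>\<delta>>0. \<forall>a a' b b' K. cmod a = 1 \<longrightarrow> cmod a' = 1 \<longrightarrow> cmod b = 1 \<longrightarrow> cmod b' = 1 \<longrightarrow>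
     admissible K \<longrightarrow> cmod (a' - a) < \<delta> \<longrightarrow> cmod (b' - b) < \<delta> \<longrightarrow> (\<forall>z. \<bar>K (a' * z) - K z\<bar> \<le> \<delta>) \<longrightarrow>
     dist (cob a' b' (\<lambda>z. G z + K z)) (cob a b G) < e"
proof -
  have "uniformly_continuous_on (cball 0 2) G"
    using G unfolding admissible_def
    by (intro compact_uniformly_continuous) (auto intro: continuous_on_subset)
  then obtain d where d: "d > 0"
    and dG: "\<And>x y. x \<in> cball 0 2 \<Longrightarrow> y \<in> cball 0 2 \<Longrightarrow> dist y x < d \<Longrightarrow> dist (G y) (G x) < e / 5"
    unfolding uniformly_continuous_on_def using e by (metis divide_pos_pos zero_less_numeral)
  \<comment> \<open>The bound d / 2 compensates the factor cmod z \<le> 2. The changes caused by a,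
    b, G and K then cost at most e / 5 each.\<close>
  define \<delta> where "\<delta> = min (d / 2) (e / 5)"
  have dpos: "\<delta> > 0" unfolding \<delta>_def using d e by simp
  show ?thesis
  proof (intro exI[of _ \<delta>] conjI allI impI dpos)
    fix a a' b b' :: complex and K
    assume a: "cmod a = 1" and a': "cmod a' = 1" and b: "cmod b = 1" and b': "cmod b' = 1"
      and K: "admissible K" and da: "cmod (a' - a) < \<delta>" and db: "cmod (b' - b) < \<delta>"
      and dK: "\<forall>z. \<bar>K (a' * z) - K z\<bar> \<le> \<delta>"
    have Gd: "\<bar>G (a' * z) - G (a * z)\<bar> \<le> e / 5" for z
    proof (cases "cmod z \<le> 2")
      case True
      have "dist (a' * z) (a * z) = cmod (a' - a) * cmod z"
        by (simp add: dist_norm left_diff_distrib[symmetric] norm_mult)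
      also have "\<dots> \<le> cmod (a' - a) * 2" using True by (intro mult_left_mono) auto
      also have "\<dots> < d" using da unfolding \<delta>_def by linarith
      finally show ?thesis using dG[of "a * z" "a' * z"] True a a' by (simp add: norm_mult dist_real_def)
    next
      case False
      then have "G (a' * z) = 0" "G (a * z) = 0" using G a a' by (auto simp: admissible_def norm_mult)
      then show ?thesis using e by simp
    qed
    have "dist (snd (cob a' b' (\<lambda>z. G z + K z))) (snd (cob a b G)) \<le> 3 * (e / 5)"
    proof (rule dist_bound)
      fix z
      let ?x = "G (a' * z) + K (a' * z) - (G z + K z)" and ?y = "G (a * z) - G z"
      have "b' * cis ?x - b * cis ?y = (b' - b) * cis ?x + b * (cis ?x - cis ?y)"
        by (simp add: algebra_simps)
      also have "cmod \<dots> \<le> cmod (b' - b) + cmod (cis ?x - cis ?y)"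
        by (rule norm_triangle_le) (simp add: norm_mult b)
      also have "\<dots> \<le> cmod (b' - b) + \<bar>?x - ?y\<bar>" using cmod_cis_diff_le[of ?x ?y] by simp
      also have "\<bar>?x - ?y\<bar> \<le> \<bar>G (a' * z) - G (a * z)\<bar> + \<bar>K (a' * z) - K z\<bar>" by linarith
      also have "\<dots> \<le> e / 5 + \<delta>" using Gd dK by (intro add_mono) auto
      finally have "cmod (b' * cis ?x - b * cis ?y) \<le> 3 * (e / 5)" using db unfolding \<delta>_def by linarith
      then show "dist (apply_bcontfun (snd (cob a' b' (\<lambda>z. G z + K z))) z) (apply_bcontfun (snd (cob a b G)) z) \<le> 3 * (e / 5)"
        by (simp add: apply_cob admissible_add G K dist_norm)
    qed
    moreover have "dist (fst (cob a' b' (\<lambda>z. G z + K z))) (fst (cob a b G)) < e / 5"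
      using da unfolding \<delta>_def by (simp add: dist_norm)
    moreover have "dist (cob a' b' (\<lambda>z. G z + K z)) (cob a b G)
       \<le> dist (fst (cob a' b' (\<lambda>z. G z + K z))) (fst (cob a b G)) + dist (snd (cob a' b' (\<lambda>z. G z + K z))) (snd (cob a b G))"
      unfolding dist_prod_def by (rule sqrt_sum_squares_le_sum) auto
    ultimately show "dist (cob a' b' (\<lambda>z. G z + K z)) (cob a b G) < e" using e by linarith
  qed
qed

lemma closure_coboundaries:
  assumes "p \<in> closure coboundaries"
  shows "cmod (fst p) = 1" "cmod (apply_bcontfun (snd p) z) = 1"
proof -
  have "closed {p :: complex \<times> (complex \<Rightarrow>\<^sub>C complex). cmod (fst p) = 1 \<and> cmod (apply_bcontfun (snd p) z) = 1}"
    by (intro closed_Collect_conj closed_Collect_eq continuous_intros continuous_on_bcontfun_apply)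
  moreover have "coboundaries \<subseteq> {p. cmod (fst p) = 1 \<and> cmod (apply_bcontfun (snd p) z) = 1}"
    unfolding coboundaries_def by (auto simp: apply_cob norm_mult)
  ultimately have "p \<in> {p. cmod (fst p) = 1 \<and> cmod (apply_bcontfun (snd p) z) = 1}"
    using assms closure_minimal by blast
  then show "cmod (fst p) = 1" "cmod (apply_bcontfun (snd p) z) = 1" by auto
qed

definition close_to_on_torus :: "real \<Rightarrow> nat \<Rightarrow> (complex \<times> complex \<Rightarrow> complex \<times> complex) \<Rightarrow> (complex \<times> (complex \<Rightarrow>\<^sub>C complex)) set" where
  "close_to_on_torus e n R = {p. \<forall>x\<in>torus. dist ((skew p ^^ n) x) (R x) < e}"

lemma compact_torus: "compact torus"
  by (intro compact_Times compact_sphere)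

text \<open>By compactness of the torus, the tube lemma turns a condition open in p and x together
  into one open in p.\<close>

lemma open_close_to_on_torus:
  assumes R: "continuous_on UNIV R"
  shows "open (close_to_on_torus e n R)"
  unfolding open_subopen[of "close_to_on_torus e n R"]
proof
  fix p assume p: "p \<in> close_to_on_torus e n R"
  let ?W = "{y. dist ((skew (fst y) ^^ n) (snd y)) (R (snd y)) < e}"
  have "continuous_on UNIV (\<lambda>y :: (complex \<times> (complex \<Rightarrow>\<^sub>C complex)) \<times> complex \<times> complex. R (snd y))"
    by (rule continuous_on_compose2[OF R]) (auto intro!: continuous_intros)
  then have "open ?W"
    by (intro open_Collect_less continuous_intros continuous_on_skew_funpow)
  moreover have "{p} \<times> torus \<subseteq> ?W" using p unfolding close_to_on_torus_def by auto
  ultimately obtain X0 where X0: "p \<in> X0" "open X0" "X0 \<times> torus \<subseteq> ?W"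
    using Elementary_Topology.tube_lemma[OF compact_torus, of ?W p] by auto
  have "X0 \<subseteq> close_to_on_torus e n R"
  proof
    fix p' assume "p' \<in> X0"
    then have "(p', x) \<in> ?W" if "x \<in> torus" for x
      using that X0(3) by blast
    then show "p' \<in> close_to_on_torus e n R" unfolding close_to_on_torus_def by simp
  qed
  then show "\<exists>T. open T \<and> p \<in> T \<and> T \<subseteq> close_to_on_torus e n R"
    using X0(1,2) by blast
qed

section \<open>Perturbations of coboundaries\<close>

text \<open>G is kept, and a and b move to nearby n-th roots of the targets. As n0 depends on p and
  e only, n can later be taken prime or a multiple of a given number.\<close>

lemma dense_coboundaries_power:
  assumes p: "p \<in> coboundaries" and e: "e > 0"
  shows "\<exists>n0. \<forall>n\<ge>n0. \<forall>\<alpha> \<beta>. cmod \<alpha> = 1 \<longrightarrow> cmod \<beta> = 1 \<longrightarrow>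
     (\<exists>a b G. cmod a = 1 \<and> cmod b = 1 \<and> admissible G \<and> dist (cob a b G) p < e \<and> a ^ n = \<alpha> \<and> b ^ n = \<beta>)"
proof -
  obtain a b G where abG: "p = cob a b G" "cmod a = 1" "cmod b = 1" "admissible G"
    using p unfolding coboundaries_def by blast
  obtain \<delta> where d: "\<delta> > 0"
    and small: "\<And>a' b' K. \<lbrakk>cmod a' = 1; cmod b' = 1; admissible K; cmod (a' - a) < \<delta>; cmod (b' - b) < \<delta>;
       \<And>z. \<bar>K (a' * z) - K z\<bar> \<le> \<delta>\<rbrakk> \<Longrightarrow> dist (cob a' b' (\<lambda>z. G z + K z)) p < e"
    using dist_cob_small[OF abG(4) e] abG(2,3) unfolding abG(1) by blast
  obtain n0 where n0: "\<And>n a \<beta>. \<lbrakk>n \<ge> n0; cmod a = 1; cmod \<beta> = 1\<rbrakk> \<Longrightarrow>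
     \<exists>a'. cmod a' = 1 \<and> cmod (a' - a) < \<delta> \<and> a' ^ n = \<beta>"
    using ex_near_root_on_circle[OF d] by blast
  show ?thesis
  proof (intro exI[of _ n0] allI impI)
    fix n \<alpha> \<beta> assume n: "n \<ge> n0" and \<alpha>: "cmod \<alpha> = 1" and \<beta>: "cmod \<beta> = 1"
    obtain a' where a': "cmod a' = 1" "cmod (a' - a) < \<delta>" "a' ^ n = \<alpha>"
      using n0[OF n abG(2) \<alpha>] by blast
    obtain b' where b': "cmod b' = 1" "cmod (b' - b) < \<delta>" "b' ^ n = \<beta>"
      using n0[OF n abG(3) \<beta>] by blast
    have "dist (cob a' b' (\<lambda>z. G z + 0)) p < e"
      using small[OF a'(1) b'(1) admissible_zero a'(2) b'(2)] d by simp
    then show "\<exists>a b G. cmod a = 1 \<and> cmod b = 1 \<and> admissible G \<and> dist (cob a b G) p < e \<and> a ^ n = \<alpha> \<and> b ^ n = \<beta>"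
      using a' b' abG(4) by (intro exI[of _ a'] exI[of _ b'] exI[of _ G]) simp
  qed
qed

text \<open>The order of a divides 2 ^ Suc k but not 2 ^ k, hence equals 2 ^ Suc k. The induction
  passes from a to its square.\<close>

lemma power_neq_one_if_two_power_minus_one:
  fixes a :: complex
  assumes "a ^ (2 ^ k) = -1" "0 < j" "j < 2 ^ Suc k"
  shows "a ^ j \<noteq> 1"
  using assms
proof (induction k arbitrary: a j)
  case 0
  then have "j = 1" by simp
  then show ?case using 0 by simp
next
  case (Suc k)
  show ?case
  proof (cases "even j")
    case True
    then obtain i where i: "j = 2 * i" by blast
    have "(a ^ 2) ^ (2 ^ k) = -1" using Suc.prems(1) by (simp add: power_mult[symmetric])
    then have "(a ^ 2) ^ i \<noteq> 1" using Suc.prems i by (intro Suc.IH) auto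
    then show ?thesis unfolding i by (simp add: power_mult)
  next
    case False
    show ?thesis
    proof
      assume "a ^ j = 1"
      then have "(a ^ (2 ^ Suc k)) ^ j = 1" by (metis mult.commute power_mult power_one)
      then show False using Suc.prems(1) False by simp
    qed
  qed
qed

text \<open>McShane's extension: \<open>\<kappa>\<close> is the lower envelope of the cones of slope
  \<open>\<epsilon>\<close> standing over the points of D.\<close>

lemma lipschitz_extension_nat:
  fixes D :: "nat set" and \<tau> :: "nat \<Rightarrow> real"
  assumes D: "finite D" "D \<noteq> {}" and eps: "\<epsilon> \<ge> 0"
    and lip: "\<And>i j. i \<in> D \<Longrightarrow> j \<in> D \<Longrightarrow> \<tau> i - \<tau> j \<le> \<epsilon> * \<bar>real i - real j\<bar>"
  shows "\<exists>\<kappa>. (\<forall>i\<in>D. \<kappa> i = \<tau> i) \<and> (\<forall>k. \<bar>\<kappa> (Suc k) - \<kappa> k\<bar> \<le> \<epsilon>)"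
proof -
  define \<kappa> where "\<kappa> k = Min ((\<lambda>i. \<tau> i + \<epsilon> * \<bar>real k - real i\<bar>) ` D)" for k
  have le: "\<kappa> k \<le> \<tau> i + \<epsilon> * \<bar>real k - real i\<bar>" if "i \<in> D" for k i
    unfolding \<kappa>_def using D that by (intro Min_le) auto
  have att: "\<exists>i\<in>D. \<kappa> k = \<tau> i + \<epsilon> * \<bar>real k - real i\<bar>" for k
  proof -
    have "\<kappa> k \<in> (\<lambda>i. \<tau> i + \<epsilon> * \<bar>real k - real i\<bar>) ` D"
      unfolding \<kappa>_def using D by (intro Min_in) auto
    then show ?thesis by blast
  qed
  have step: "\<kappa> k \<le> \<kappa> l + \<epsilon>" if kl: "\<bar>real k - real l\<bar> \<le> 1" for k l
  proof -
    obtain i where i: "i \<in> D" "\<kappa> l = \<tau> i + \<epsilon> * \<bar>real l - real i\<bar>" using att by blast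
    have "\<bar>real k - real i\<bar> \<le> \<bar>real l - real i\<bar> + 1" using kl by linarith
    then have "\<epsilon> * \<bar>real k - real i\<bar> \<le> \<epsilon> * (\<bar>real l - real i\<bar> + 1)" using eps by (rule mult_left_mono)
    then show ?thesis using le[OF i(1), of k] i(2) by (simp add: distrib_left)
  qed
  show ?thesis
  proof (intro exI[of _ \<kappa>] conjI ballI allI)
    fix i assume i: "i \<in> D"
    obtain j where j: "j \<in> D" "\<kappa> i = \<tau> j + \<epsilon> * \<bar>real i - real j\<bar>" using att by blast
    show "\<kappa> i = \<tau> i" using le[OF i, of i] j lip[OF i j(1)] by simp
  next
    fix k show "\<bar>\<kappa> (Suc k) - \<kappa> k\<bar> \<le> \<epsilon>"
      using step[of k "Suc k"] step[of "Suc k" k] by simp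
  qed
qed

text \<open>
  \<open>K\<close> is a sum of bumps of height \<open>\<kappa> k\<close> and equal width around the points \<open>a ^ k\<close>.  The
  rotation by \<open>a\<close> carries each bump to the next one, so \<open>K\<close> varies along orbits as slowly as \<open>\<kappa>\<close>.
\<close>

lemma admissible_with_values_on_orbit:
  assumes a: "cmod a = 1" and nz: "\<And>j. 0 < j \<Longrightarrow> j \<le> M \<Longrightarrow> a ^ j \<noteq> 1"
    and k0: "\<kappa> 0 = (0::real)" and kM: "\<kappa> M = 0" and lip: "\<And>k. \<bar>\<kappa> (Suc k) - \<kappa> k\<bar> \<le> \<epsilon>"
  shows "\<exists>K. admissible K \<and> (\<forall>k\<le>M. K (a ^ k) = \<kappa> k) \<and> (\<forall>z. \<bar>K (a * z) - K z\<bar> \<le> \<epsilon>)"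
proof -
  have a0: "a \<noteq> 0" using a by auto
  have lt: "a ^ i \<noteq> a ^ j" if "i < j" "j \<le> M" for i j
  proof
    assume "a ^ i = a ^ j"
    also have "a ^ j = a ^ i * a ^ (j - i)" using that by (simp add: power_add[symmetric])
    finally have "a ^ (j - i) = 1" using a0 by simp
    then show False using nz[of "j - i"] that by simp
  qed
  have inj: "a ^ i \<noteq> a ^ j" if "i \<noteq> j" "i \<le> M" "j \<le> M" for i j
    using that lt[of i j] lt[of j i] by (metis nat_neq_iff)
  \<comment> \<open>The element 1 keeps the set nonempty when M = 0 and bounds the bump radius
    \<open>\<eta>\<close>, so that all bumps live in the disc of radius 2.\<close>
  define Ds where "Ds = insert 1 ((\<lambda>(i, j). dist (a ^ i) (a ^ j)) ` {(i, j). i \<le> M \<and> j \<le> M \<and> i \<noteq> j})"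
  have "finite ({..M} \<times> {..M})" by simp
  then have "finite {(i, j). i \<le> M \<and> j \<le> M \<and> i \<noteq> j}" by (rule rev_finite_subset) auto
  then have finD: "finite Ds" unfolding Ds_def by simp
  define \<eta> where "\<eta> = Min Ds / 2"
  have "Min Ds > 0" using finD inj unfolding Ds_def by (subst Min_gr_iff) auto
  then have eta: "\<eta> > 0" unfolding \<eta>_def by simp
  have "Min Ds \<le> 1" using finD unfolding Ds_def by (intro Min_le) auto
  then have eta1: "\<eta> \<le> 1" unfolding \<eta>_def by simp
  have sep: "2 * \<eta> \<le> cmod (a ^ i - a ^ j)" if "i \<noteq> j" "i \<le> M" "j \<le> M" for i j
  proof -
    have "dist (a ^ i) (a ^ j) \<in> Ds" using that unfolding Ds_def by force
    then show ?thesis using finD unfolding \<eta>_def by (simp add: dist_norm)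
  qed
  define B where "B k z = max 0 (1 - cmod (z - a ^ k) / \<eta>)" for k z
  have B0: "B k z \<ge> 0" for k z unfolding B_def by simp
  have B1: "B k z \<le> 1" for k z unfolding B_def using eta by simp
  have Bzero: "B k z = 0" if "cmod (z - a ^ k) \<ge> \<eta>" for k z
    unfolding B_def using eta that by simp
  have Bshift: "B (Suc k) (a * z) = B k z" for k z
  proof -
    have "cmod (a * z - a ^ Suc k) = cmod (z - a ^ k)"
      using a by (simp add: right_diff_distrib[symmetric] norm_mult)
    then show ?thesis unfolding B_def by simp
  qed
  \<comment> \<open>The centres are at least 2 * \<open>\<eta>\<close> apart, so at most one bump is
    nonzero at any z.\<close>
  have sumB: "(\<Sum>k<M. B k z) \<le> 1" for z
  proof (cases "\<exists>k<M. B k z \<noteq> 0")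
    case False
    then show ?thesis by simp
  next
    case True
    then obtain k where k: "k < M" "B k z \<noteq> 0" by blast
    then have zk: "cmod (z - a ^ k) < \<eta>" using Bzero[of z k] by linarith
    have "B j z = 0" if "j < M" "j \<noteq> k" for j
    proof (rule Bzero)
      have "2 * \<eta> \<le> cmod (a ^ k - a ^ j)" using sep[of k j] that k by simp
      also have "a ^ k - a ^ j = (z - a ^ j) - (z - a ^ k)" by simp
      also have "cmod \<dots> \<le> cmod (z - a ^ j) + cmod (z - a ^ k)" by (rule norm_triangle_ineq4)
      finally show "\<eta> \<le> cmod (z - a ^ j)" using zk by linarith
    qed
    then have "(\<Sum>j<M. B j z) = (\<Sum>j\<in>{k}. B j z)" using k by (intro sum.mono_neutral_right) auto
    then show ?thesis using B1[of k z] by simp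
  qed
  define K where "K z = (\<Sum>k<Suc M. \<kappa> k * B k z)" for z
  have "continuous_on UNIV K" unfolding K_def B_def using eta by (intro continuous_intros) auto
  moreover have "K z = 0" if "cmod z \<ge> 2" for z
  proof -
    have "cmod (z - a ^ k) \<ge> \<eta>" for k
      using norm_triangle_ineq2[of z "a ^ k"] that eta1 a by (simp add: norm_power)
    then show ?thesis unfolding K_def using Bzero by simp
  qed
  ultimately have adm: "admissible K" unfolding admissible_def by blast
  have val: "K (a ^ k) = \<kappa> k" if k: "k \<le> M" for k
  proof -
    have "B j (a ^ k) = 0" if "j \<noteq> k" "j \<le> M" for j
      using sep[of k j] that k eta by (intro Bzero) simp
    then have "K (a ^ k) = (\<Sum>j\<in>{k}. \<kappa> j * B j (a ^ k))" unfolding K_def using k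
      by (intro sum.mono_neutral_right) auto
    then show ?thesis by (simp add: B_def)
  qed
  have diff: "\<bar>K (a * z) - K z\<bar> \<le> \<epsilon>" for z
  proof -
    have eps: "\<epsilon> \<ge> 0" using lip[of 0] by linarith
    \<comment> \<open>The first and the last bump have height 0, so the index shift loses nothing at
      the ends and only increments of \<open>\<kappa>\<close> remain.\<close>
    have "K (a * z) = (\<Sum>k<M. \<kappa> (Suc k) * B k z)"
      unfolding K_def by (subst sum.lessThan_Suc_shift) (simp add: k0 Bshift)
    moreover have "K z = (\<Sum>k<M. \<kappa> k * B k z)" unfolding K_def by (simp add: kM)
    ultimately have "K (a * z) - K z = (\<Sum>k<M. (\<kappa> (Suc k) - \<kappa> k) * B k z)"
      by (simp add: sum_subtractf left_diff_distrib)
    also have "\<bar>\<dots>\<bar> \<le> (\<Sum>k<M. \<bar>(\<kappa> (Suc k) - \<kappa> k) * B k z\<bar>)" by (rule sum_abs)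
    also have "\<dots> \<le> (\<Sum>k<M. \<epsilon> * B k z)"
      by (intro sum_mono) (use lip B0 in \<open>simp add: abs_mult mult_right_mono\<close>)
    also have "\<dots> \<le> \<epsilon>" using sumB[of z] eps by (simp add: sum_distrib_left[symmetric] mult_left_le)
    finally show ?thesis .
  qed
  show ?thesis using adm val diff by blast
qed

section \<open>Prescribing the power average\<close>

lemma near_power_residue_mod:
  "near_power_residue C r L (x mod r) \<longleftrightarrow> near_power_residue C r L x"
  unfolding near_power_residue_def cong_def by (simp add: mod_add_left_eq)

text \<open>The weights count the t with a given residue t ^ C, so grouping by residues makes the
  sum over t unweighted.\<close>

lemma sum_power_count:
  fixes g :: "nat \<Rightarrow> complex"
  assumes "r > 0"
  shows "(\<Sum>i<r. of_nat (power_count C r (int i)) * g i) = (\<Sum>t\<in>{1..r}. g (t ^ C mod r))"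
proof -
  have "of_nat (power_count C r (int i)) * g i = (\<Sum>t\<in>{t \<in> {1..r}. t ^ C mod r = i}. g (t ^ C mod r))"
    if "i < r" for i
  proof -
    have "[int t ^ C = int i] (mod int r) \<longleftrightarrow> t ^ C mod r = i" for t
      using cong_int_iff[of "t ^ C" i r] that by (simp add: cong_def)
    then have "power_count C r (int i) = card {t \<in> {1..r}. t ^ C mod r = i}"
      unfolding power_count_def by simp
    moreover have "(\<Sum>t\<in>{t \<in> {1..r}. t ^ C mod r = i}. g (t ^ C mod r)) = (\<Sum>t\<in>{t \<in> {1..r}. t ^ C mod r = i}. g i)"
      by (intro sum.cong) auto
    ultimately show ?thesis by simp
  qed
  then have "(\<Sum>i<r. of_nat (power_count C r (int i)) * g i)
     = (\<Sum>i<r. \<Sum>t\<in>{t \<in> {1..r}. t ^ C mod r = i}. g (t ^ C mod r))"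
    by (intro sum.cong) auto
  also have "\<dots> = (\<Sum>t\<in>{1..r}. g (t ^ C mod r))"
    using assms by (intro sum.group) auto
  finally show ?thesis .
qed

definition power_average :: "nat \<Rightarrow> nat \<Rightarrow> complex \<times> (complex \<Rightarrow>\<^sub>C complex) \<Rightarrow> complex" where
  "power_average C r p = 1 / of_nat r *
     (\<Sum>i<r. of_nat (power_count C r (int i)) * snd ((skew p ^^ i) (1, 1)))"

lemma continuous_on_power_average: "continuous_on UNIV (power_average C r)"
  unfolding power_average_def by (intro continuous_intros continuous_on_skew_funpow)

text \<open>In the application 1 \<le> t \<le> r, so t = r is the only index with residue 0, where
  the phase cannot be prescribed.\<close>

lemma squarefree_dvd_power:
  fixes r t :: nat
  assumes "squarefree r" "r dvd t ^ C"
  shows "r dvd t"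
proof -
  obtain u where u: "r = gcd r t * u" by (metis dvd_def gcd_dvd1)
  have "u = 1"
  proof (rule ccontr)
    assume "u \<noteq> 1"
    then obtain p where p: "prime p" "p dvd u" using prime_factor_nat by blast
    have pr: "p dvd r" using p(2) u by (metis dvd_mult)
    then have "p dvd t ^ C" using assms(2) by (rule dvd_trans)
    then have "p dvd t" using p(1) prime_dvd_power by blast
    then have "p dvd gcd r t" using pr by simp
    then have "p * p dvd gcd r t * u" using p(2) by (rule mult_dvd_mono)
    then have "p ^ 2 dvd r" using u by (simp add: power2_eq_square)
    then show False using assms(1) p(1) squarefreeD not_prime_unit by blast
  qed
  then show ?thesis using u by (metis gcd_dvd2 mult.right_neutral)
qed

text \<open>
  Replacing \<open>G\<close> by \<open>G + K\<close> multiplies the second coordinate of the \<open>i\<close>-th orbit point by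
  \<open>cis (\<kappa> i)\<close>.  Only a slowly varying \<open>\<kappa>\<close> keeps the map close to the given one, but this still
  permits independent prescriptions at indices that are far apart, hence at most power residues
  modulo a suitable \<open>r\<close>.
\<close>

lemma dense_power_average:
  assumes p: "p \<in> coboundaries" and e: "e > 0" and C: "C \<ge> 2"
    and h2: "filterlim h2 at_top sequentially" and c: "cmod c = 1"
  shows "\<exists>p'\<in>coboundaries. dist p' p < e \<and> (\<exists>r>N. squarefree r \<and> (\<forall>p. prime p \<and> p dvd r \<longrightarrow> p > N) \<and>
     real (num_prime_divisors r) < h2 r \<and> cmod (power_average C r p' - c) < 1 / 2)"
proof -
  obtain a b G where abG: "p = cob a b G" "cmod a = 1" "cmod b = 1" "admissible G"
    using p unfolding coboundaries_def by blast
  obtain \<delta> where d: "\<delta> > 0"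
    and small: "\<And>a' b' K. \<lbrakk>cmod a' = 1; cmod b' = 1; admissible K; cmod (a' - a) < \<delta>; cmod (b' - b) < \<delta>;
       \<And>z. \<bar>K (a' * z) - K z\<bar> \<le> \<delta>\<rbrakk> \<Longrightarrow> dist (cob a' b' (\<lambda>z. G z + K z)) p < e"
    using dist_cob_small[OF abG(4) e] abG(2,3) unfolding abG(1) by blast
  \<comment> \<open>Prescribed phases are values of \<open>Arg\<close> or 0 and differ by at most 2
    * pi; over L steps, increments of size \<open>\<delta>\<close> can make up such a
    difference.\<close>
  obtain L :: nat where L: "2 * pi / \<delta> < real L" using reals_Archimedean2 by blast
  have Lpos: "L > 0" using L d pi_gt_zero by (cases L) (auto simp: divide_less_0_iff)
  have Ld: "2 * pi \<le> \<delta> * real L" using L d by (simp add: field_simps)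
  obtain r where r: "r > N" "squarefree r" "\<forall>p. prime p \<and> p dvd r \<longrightarrow> p > N"
      "real (num_prime_divisors r) < h2 r"
    and bad: "real (card {t \<in> {1..r}. t = r \<or> near_power_residue C r L (t ^ C)}) < real r / 4"
    using ex_modulus_isolated_power_residues[OF C h2, of N L] by blast
  have r0: "r > 0" using r(1) by simp
  \<comment> \<open>An end marker, more than L beyond every residue, at which the phase correction
    is back at 0 as the bump construction demands.\<close>
  define M where "M = r + L"
  obtain n0 where n0: "\<And>n a \<beta>. \<lbrakk>n \<ge> n0; cmod a = 1; cmod \<beta> = 1\<rbrakk> \<Longrightarrow>
     \<exists>a'. cmod a' = 1 \<and> cmod (a' - a) < \<delta> \<and> a' ^ n = \<beta>"
    using ex_near_root_on_circle[OF d] by blast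
  \<comment> \<open>The exponent 2 ^ (n0 + M) is at least n0, so a has a nearby root a' of -1; and
    a' has order above M, so its powers up to M are distinct.\<close>
  have big: "n0 + M < 2 ^ (n0 + M)" by (rule less_exp)
  then have "(2 :: nat) ^ (n0 + M) \<ge> n0" by linarith
  then obtain a' where a': "cmod a' = 1" "cmod (a' - a) < \<delta>" "a' ^ (2 ^ (n0 + M)) = -1"
    using n0[of "2 ^ (n0 + M)" a "-1"] abG(2) by auto
  have anz: "a' ^ j \<noteq> 1" if "0 < j" "j \<le> M" for j
  proof (rule power_neq_one_if_two_power_minus_one[OF a'(3) that(1)])
    show "j < 2 ^ Suc (n0 + M)" using that(2) big unfolding power_Suc by linarith
  qed
  define w where "w i = b ^ i * cis (G (a' ^ i) - G 1)" for i
  have wunit: "cmod (w i) = 1" for i unfolding w_def using abG by (simp add: norm_mult norm_power)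
  define P where "P = (\<lambda>t. t ^ C mod r) ` {1..r}"
  \<comment> \<open>Index 0 is the start of the orbit. No correction is possible there, since the
    orbit only sees K (a' ^ i) - K 1.\<close>
  define I where "I = {i \<in> P. i \<noteq> 0 \<and> \<not> near_power_residue C r L i}"
  define \<tau> where "\<tau> i = (if i \<in> I then Arg (c / w i) else 0)" for i
  have cis_tau: "cis (\<tau> i) = c / w i" if "i \<in> I" for i
  proof -
    have "cmod (c / w i) = 1" using c wunit by (simp add: norm_divide)
    then have "cis (Arg (c / w i)) = c / w i"
      using cis_Arg[of "c / w i"] by (metis div_by_1 norm_zero of_real_1 sgn_eq zero_neq_one)
    then show ?thesis using that unfolding \<tau>_def by simp
  qed
  have tau_bd: "\<tau> i - \<tau> j \<le> 2 * pi" for i j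
    unfolding \<tau>_def using Arg_bounded[of "c / w i"] Arg_bounded[of "c / w j"] by auto
  have IP: "i < r" "i > 0" if "i \<in> I" for i using that r0 unfolding I_def P_def by auto
  have sep_less: "j - i > L" if i: "i \<in> insert 0 I" and j: "j \<in> insert M I" and ij: "i < j" for i j
  proof (cases "j = M")
    case True
    have "i < r" using i IP r0 by auto
    then show ?thesis unfolding True M_def by simp
  next
    case False
    then have jI: "j \<in> I" using j by blast
    then obtain s where s: "j = s ^ C mod r" unfolding I_def P_def by auto
    show ?thesis
    proof (rule ccontr)
      assume "\<not> j - i > L"
      then have jl: "0 < j - i" "j - i \<le> L" using ij by auto
      show False
      proof (cases "i = 0")
        case True
        then have "[j = 0 ^ C + j] (mod r)" "0 < j" "j \<le> L" using C jl by (auto simp: power_0_left)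
        then have "near_power_residue C r L j" unfolding near_power_residue_def by blast
        then show False using jI unfolding I_def by simp
      next
        case False
        have "[s ^ C = i + (j - i)] (mod r)" using s ij by (simp add: cong_def)
        then have "near_power_residue C r L i" using jl unfolding near_power_residue_def by blast
        then show False using i False unfolding I_def by simp
      qed
    qed
  qed
  have finP: "finite P" unfolding P_def by simp
  let ?D = "I \<union> {0, M}"
  have sep: "real L \<le> real j - real i" if "i \<in> ?D" "j \<in> ?D" "i < j" for i j
  proof -
    have "j \<le> M" using that(2) IP[of j] unfolding M_def by auto
    then have "i \<in> insert 0 I" using that(1,3) by auto
    moreover have "j \<in> insert M I" using that(2,3) by auto
    ultimately have "j - i > L" using that(3) by (rule sep_less)
    then show ?thesis by linarith
  qed
  have lip: "\<tau> i - \<tau> j \<le> \<delta> * \<bar>real i - real j\<bar>" if "i \<in> ?D" "j \<in> ?D" for i j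
  proof (cases "i = j")
    case True
    then show ?thesis by simp
  next
    case False
    then have "real L \<le> \<bar>real i - real j\<bar>"
      using sep[of i j] sep[of j i] that by (cases "i < j") auto
    then have "\<delta> * real L \<le> \<delta> * \<bar>real i - real j\<bar>" using d by simp
    then show ?thesis using tau_bd[of i j] Ld by linarith
  qed
  have "finite ?D" using finP unfolding I_def by simp
  then obtain \<kappa> where \<kappa>: "\<And>i. i \<in> ?D \<Longrightarrow> \<kappa> i = \<tau> i" "\<And>k. \<bar>\<kappa> (Suc k) - \<kappa> k\<bar> \<le> \<delta>"
    using lipschitz_extension_nat[of ?D \<delta> \<tau>, OF _ _ _ lip] d by (auto simp: less_imp_le)
  have "0 \<notin> I" "M \<notin> I" using IP unfolding M_def by force+
  then have \<kappa>0: "\<kappa> 0 = 0" "\<kappa> M = 0" using \<kappa>(1)[of 0] \<kappa>(1)[of M] unfolding \<tau>_def by auto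
  obtain K where K: "admissible K" "\<And>k. k \<le> M \<Longrightarrow> K (a' ^ k) = \<kappa> k" "\<And>z. \<bar>K (a' * z) - K z\<bar> \<le> \<delta>"
    using admissible_with_values_on_orbit[OF a'(1) anz \<kappa>0 \<kappa>(2)] by blast
  define p' where "p' = cob a' b (\<lambda>z. G z + K z)"
  have adm: "admissible (\<lambda>z. G z + K z)" using abG(4) K(1) by (rule admissible_add)
  have p'c: "p' \<in> coboundaries" unfolding p'_def using a'(1) abG(3) adm by (rule cob_in_coboundaries)
  have p'd: "dist p' p < e" unfolding p'_def using small[OF a'(1) abG(3) K(1) a'(2) _ K(3)] d by simp
  define g where "g i = snd ((skew p' ^^ i) (1, 1))" for i
  have g: "g i = b ^ i * cis (G (a' ^ i) + K (a' ^ i) - (G 1 + K 1))" for i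
    unfolding g_def p'_def by (simp add: skew_funpow_cob[OF adm])
  have gunit: "cmod (g i) = 1" for i unfolding g using abG by (simp add: norm_mult norm_power)
  have gI: "g i = c" if i: "i \<in> I" for i
  proof -
    have "K (a' ^ i) = \<tau> i" using K(2)[of i] \<kappa>(1)[of i] IP(1)[OF i] i unfolding M_def by simp
    moreover have "K 1 = 0" using K(2)[of 0] \<kappa>0 by simp
    ultimately have "g i = b ^ i * cis ((G (a' ^ i) - G 1) + \<tau> i)" unfolding g by (simp add: algebra_simps)
    also have "\<dots> = w i * cis (\<tau> i)" unfolding w_def by (simp only: cis_mult[symmetric] mult.assoc)
    also have "\<dots> = c" using cis_tau[OF i] wunit[of i] by auto
    finally show ?thesis .
  qed
  let ?bad = "{t \<in> {1..r}. t = r \<or> near_power_residue C r L (t ^ C)}"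
  define m where "m = card ?bad"
  have m: "real m < real r / 4" using bad unfolding m_def .
  have good: "g (t ^ C mod r) = c" if t: "t \<in> {1..r} - ?bad" for t
  proof (rule gI)
    have "t ^ C mod r \<noteq> 0"
    proof
      assume "t ^ C mod r = 0"
      then have "r dvd t ^ C" by (simp add: dvd_eq_mod_eq_0)
      then have "r dvd t" by (rule squarefree_dvd_power[OF r(2)])
      then show False using t by (auto dest: dvd_imp_le)
    qed
    then show "t ^ C mod r \<in> I" using t unfolding I_def P_def by (auto simp: near_power_residue_mod)
  qed
  have "power_average C r p' = (1 / of_nat r) * (\<Sum>i<r. of_nat (power_count C r (int i)) * g i)"
    unfolding power_average_def g_def ..
  also have "\<dots> = (1 / of_nat r) * (\<Sum>t\<in>{1..r}. g (t ^ C mod r))"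
    by (simp only: sum_power_count[OF r0])
  finally have avg: "power_average C r p' = (1 / of_nat r) * (\<Sum>t\<in>{1..r}. g (t ^ C mod r))" .
  have "(\<Sum>t\<in>{1..r}. g (t ^ C mod r) - c) = (\<Sum>t\<in>?bad. g (t ^ C mod r) - c)"
    using good by (intro sum.mono_neutral_right) auto
  moreover have "power_average C r p' - c = (1 / of_nat r) * (\<Sum>t\<in>{1..r}. g (t ^ C mod r) - c)"
    unfolding avg using r0 by (simp add: sum_subtractf right_diff_distrib)
  ultimately have eq: "power_average C r p' - c = (1 / of_nat r) * (\<Sum>t\<in>?bad. g (t ^ C mod r) - c)"
    by simp
  \<comment> \<open>Both terms are unimodular, so a bad index costs at most 2; fewer than r / 4 bad
    indices give an error below 1 / 2 in the average.\<close>
  have "cmod (\<Sum>t\<in>?bad. g (t ^ C mod r) - c) \<le> of_nat (card ?bad) * 2"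
  proof (rule sum_norm_bound)
    fix t show "cmod (g (t ^ C mod r) - c) \<le> 2"
      using norm_triangle_ineq4[of "g (t ^ C mod r)" c] gunit c by simp
  qed
  then have "cmod (\<Sum>t\<in>?bad. g (t ^ C mod r) - c) < real r / 2"
    using m unfolding m_def[symmetric] by simp
  then have "cmod (power_average C r p' - c) < 1 / 2"
    unfolding eq norm_mult using r0 by (simp add: norm_divide field_simps)
  then show ?thesis using p'c p'd r by blast
qed

section \<open>Invariant measures\<close>

text \<open>Indicators of closed sets are limits of continuous functions of the distance to the set,
  and the closed sets are an intersection-stable generator of the Borel sets.\<close>

lemma measure_eqI_continuous:
  fixes M N :: "'a::metric_space measure"
  assumes M: "prob_space M" "sets M = sets borel" and N: "prob_space N" "sets N = sets borel"
    and eq: "\<And>f :: 'a \<Rightarrow> real. continuous_on UNIV f \<Longrightarrow> (\<And>x. \<bar>f x\<bar> \<le> 1) \<Longrightarrow> (\<integral>x. f x \<partial>M) = (\<integral>x. f x \<partial>N)"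
  shows "M = N"
proof -
  interpret M: prob_space M by fact
  interpret N: prob_space N by fact
  have closed_eq: "measure M S = measure N S" if S: "closed S" for S
  \<comment> \<open>\<open>infdist x {}\<close> is 0, so for the empty set the approximating
    functions would be constantly 1.\<close>
  proof (cases "S = {}")
    case True
    then show ?thesis by simp
  next
    case False
    define f where "f n x = max 0 (1 - real n * infdist x S)" for n x
    have cont: "continuous_on UNIV (f n)" for n
      unfolding f_def by (intro continuous_intros)
    have bd: "\<bar>f n x\<bar> \<le> 1" for n x
      unfolding f_def using infdist_nonneg[of x S] by simp
    have lim: "(\<lambda>n. f n x) \<longlonglongrightarrow> indicator S x" for x
    proof (cases "x \<in> S")
      case True
      then show ?thesis unfolding f_def by simp
    next
      case nx: False
      then have pos: "infdist x S > 0" using infdist_pos_not_in_closed S False by blast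
      obtain n0 :: nat where n0: "1 / infdist x S < real n0" using reals_Archimedean2 by blast
      have "f n x = 0" if "n \<ge> n0" for n
      proof -
        have "1 / infdist x S \<le> real n" using n0 that by linarith
        then have "1 \<le> real n * infdist x S" using pos by (simp add: pos_divide_le_eq)
        then show ?thesis unfolding f_def by simp
      qed
      then have "eventually (\<lambda>n. f n x = 0) sequentially" unfolding eventually_sequentially by blast
      then have "(\<lambda>n. f n x) \<longlonglongrightarrow> 0" by (rule tendsto_eventually)
      then show ?thesis using nx by simp
    qed
    have int: "(\<lambda>n. \<integral>x. f n x \<partial>Q) \<longlonglongrightarrow> measure Q S" if Q: "prob_space Q" "sets Q = sets borel" for Q :: "'a measure"
    proof -
      interpret Q: prob_space Q by fact
      have meas: "f n \<in> borel_measurable Q" for n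
        using borel_measurable_continuous_onI[OF cont] measurable_cong_sets[OF Q(2) refl] by blast
      have SQ: "S \<in> sets Q" using Q(2) S by simp
      have "(\<lambda>n. \<integral>x. f n x \<partial>Q) \<longlonglongrightarrow> (\<integral>x. indicator S x \<partial>Q)"
      proof (rule integral_dominated_convergence[where w = "\<lambda>_. 1"])
        show "indicator S \<in> borel_measurable Q" using SQ by simp
      qed (use meas lim bd in auto)
      then show ?thesis using SQ by simp
    qed
    have "(\<lambda>n. \<integral>x. f n x \<partial>M) = (\<lambda>n. \<integral>x. f n x \<partial>N)"
      using eq[OF cont bd] by simp
    then show ?thesis using int[OF M] int[OF N] LIMSEQ_unique by metis
  qed
  show ?thesis
  proof (rule measure_eqI_generator_eq[where E = "Collect closed" and \<Omega> = UNIV and A = "\<lambda>_. UNIV"])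
    show "Int_stable (Collect closed)" unfolding Int_stable_def by auto
    show "sets M = sigma_sets UNIV (Collect closed)" "sets N = sigma_sets UNIV (Collect closed)"
      using M(2) N(2) by (simp_all add: borel_eq_closed)
    show "emeasure M X = emeasure N X" if "X \<in> Collect closed" for X
      using closed_eq[of X] that by (simp add: M.emeasure_eq_measure N.emeasure_eq_measure)
  qed auto
qed

text \<open>Haar measure of the unit circle, taken as a Borel measure on the plane so that
  integrands can be continuous functions on all of \<open>complex\<close>.\<close>

definition circle_measure :: "complex measure" where
  "circle_measure = distr (density lborel (indicator {0..1::real})) borel (\<lambda>t. cis (2 * pi * t))"

lemma continuous_on_cis_2pi: "continuous_on S (\<lambda>t. cis (2 * pi * t))"
  unfolding cis_conv_exp by (intro continuous_intros)

lemma sets_circle_measure [simp]: "sets circle_measure = sets borel"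
  by (simp add: circle_measure_def)

lemma measurable_cis_2pi: "(\<lambda>t. cis (2 * pi * t)) \<in> measurable (density lborel f) borel"
  using borel_measurable_continuous_onI[OF continuous_on_cis_2pi] by simp

lemma prob_space_circle_measure: "prob_space circle_measure"
  unfolding circle_measure_def
proof (rule prob_space.prob_space_distr[OF _ measurable_cis_2pi])
  show "prob_space (density lborel (indicator {0..1::real}))"
    by (rule prob_spaceI) (simp add: emeasure_density)
qed

lemma AE_circle_measure: "AE z in circle_measure. cmod z = 1"
proof -
  have "{z. cmod z = 1} \<in> sets borel" by (intro borel_closed closed_Collect_eq continuous_intros)
  then show ?thesis unfolding circle_measure_def by (subst AE_distr_iff[OF measurable_cis_2pi]) auto
qed

lemma integral_circle_measure:
  fixes h :: "complex \<Rightarrow> real"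
  assumes h: "continuous_on UNIV h"
  shows "(\<integral>z. h z \<partial>circle_measure) = integral {0..1} (\<lambda>t. h (cis (2 * pi * t)))"
proof -
  have cont: "continuous_on S (\<lambda>t. h (cis (2 * pi * t)))" for S
    by (rule continuous_on_compose2[OF h continuous_on_cis_2pi]) simp
  have meas: "h \<in> borel_measurable borel" by (rule borel_measurable_continuous_onI[OF h])
  have "(\<integral>z. h z \<partial>circle_measure) = (\<integral>t. h (cis (2 * pi * t)) \<partial>density lborel (\<lambda>x. ennreal (indicator {0..1::real} x)))"
    unfolding circle_measure_def using integral_distr[OF measurable_cis_2pi meas] by (simp add: ennreal_indicator)
  also have "\<dots> = (\<integral>t. indicator {0..1} t *\<^sub>R h (cis (2 * pi * t)) \<partial>lborel)"
    by (rule integral_density) (use borel_measurable_continuous_onI[OF cont] in auto)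
  also have "\<dots> = integral {0..1} (\<lambda>t. h (cis (2 * pi * t)))"
    unfolding set_lebesgue_integral_def[symmetric]
    by (rule set_borel_integral_eq_integral(2)) (rule borel_integrable_atLeastAtMost', rule cont)
  finally show ?thesis .
qed

text \<open>In the angle variable, rotation is translation by c of a function of period 1; the piece
  over [1, 1 + c] is moved back to [0, c].\<close>

lemma integral_circle_measure_rotate:
  fixes h :: "complex \<Rightarrow> real"
  assumes h: "continuous_on UNIV h" and b: "cmod \<beta> = 1"
  shows "(\<integral>z. h (\<beta> * z) \<partial>circle_measure) = (\<integral>z. h z \<partial>circle_measure)"
proof -
  obtain x where x: "0 \<le> x" "x < 2 * pi" "\<beta> = cis x"
    using complex_unit_circle b Arg2pi_ge_0[of \<beta>] Arg2pi_lt_2pi[of \<beta>] Arg2pi_eq[of \<beta>]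
    by (metis cis_conv_exp mult.left_neutral of_real_1)
  define c where "c = x / (2 * pi)"
  have c: "0 \<le> c" "c \<le> 1" "\<beta> = cis (2 * pi * c)" using x unfolding c_def by auto
  define g where "g t = h (cis (2 * pi * t))" for t
  have cont: "continuous_on S g" for S
    unfolding g_def by (rule continuous_on_compose2[OF h continuous_on_cis_2pi]) simp
  have per: "g (t + 1) = g t" for t
    unfolding g_def by (simp add: distrib_left cis_mult[symmetric])
  have int: "g integrable_on {a..b}" for a b by (rule integrable_continuous_real[OF cont])
  have hb: "continuous_on UNIV (\<lambda>z. h (\<beta> * z))"
    by (rule continuous_on_compose2[OF h]) (auto intro!: continuous_intros)
  have shift: "(\<lambda>t. h (\<beta> * cis (2 * pi * t))) = g \<circ> (\<lambda>t. t + c)"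
    unfolding g_def o_def c(3) cis_mult by (simp add: distrib_left add.commute)
  have "(\<integral>z. h (\<beta> * z) \<partial>circle_measure) = integral {0..1} (g \<circ> (\<lambda>t. t + c))"
    unfolding integral_circle_measure[OF hb] shift ..
  also have "\<dots> = integral {0 + c..1 + c} g" by (rule integral_shift[OF cont])
  also have "\<dots> = integral {c..1} g + integral {1..1 + c} g"
    using Henstock_Kurzweil_Integration.integral_combine[of c 1 "1 + c" g] c int by simp
  also have "integral {1..1 + c} g = integral {0..c} g"
  proof -
    have "g \<circ> (\<lambda>t. t + 1) = g" using per by (simp add: fun_eq_iff)
    then show ?thesis using integral_shift[OF cont, of 0 c 1] by (simp add: add.commute)
  qed
  also have "integral {c..1} g + integral {0..c} g = integral {0..1} g"
    using Henstock_Kurzweil_Integration.integral_combine[of 0 c 1 g] c int by simp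
  also have "\<dots> = (\<integral>z. h z \<partial>circle_measure)" unfolding integral_circle_measure[OF h] g_def ..
  finally show ?thesis .
qed

lemma Fubini_circle_measure:
  fixes M :: "'x::second_countable_topology measure" and F :: "'x \<times> complex \<Rightarrow> real"
  assumes M: "prob_space M" "sets M = sets borel"
    and F: "continuous_on UNIV F" "\<And>y. \<bar>F y\<bar> \<le> 1"
  shows "(\<integral>b. (\<integral>x. F (x, b) \<partial>M) \<partial>circle_measure) = (\<integral>x. (\<integral>b. F (x, b) \<partial>circle_measure) \<partial>M)"
    and "(\<integral>y. F y \<partial>(M \<Otimes>\<^sub>M circle_measure)) = (\<integral>x. (\<integral>b. F (x, b) \<partial>circle_measure) \<partial>M)"
proof -
  interpret M: prob_space M by fact
  interpret u: prob_space circle_measure by (rule prob_space_circle_measure)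
  interpret pair_prob_space M circle_measure ..
  have "sets (M \<Otimes>\<^sub>M circle_measure) = sets (borel \<Otimes>\<^sub>M borel :: ('x \<times> complex) measure)"
    by (rule sets_pair_measure_cong[OF M(2) sets_circle_measure])
  then have sets: "sets (M \<Otimes>\<^sub>M circle_measure) = sets (borel :: ('x \<times> complex) measure)"
    by (simp only: borel_prod)
  have "F \<in> borel_measurable (M \<Otimes>\<^sub>M circle_measure)"
    using borel_measurable_continuous_onI[OF F(1)] measurable_cong_sets[OF sets refl] by blast
  then have int: "integrable (M \<Otimes>\<^sub>M circle_measure) F"
    by (intro P.integrable_const_bound[where B = 1]) (use F(2) in auto)
  show "(\<integral>b. (\<integral>x. F (x, b) \<partial>M) \<partial>circle_measure) = (\<integral>x. (\<integral>b. F (x, b) \<partial>circle_measure) \<partial>M)"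
    using Fubini_integral[of "\<lambda>x b. F (x, b)"] int by simp
  show "(\<integral>y. F y \<partial>(M \<Otimes>\<^sub>M circle_measure)) = (\<integral>x. (\<integral>b. F (x, b) \<partial>circle_measure) \<partial>M)"
    using integral_fst'[of F] int by simp
qed

text \<open>An integral that is the same for every unimodular b may be averaged over b; Fubini's
  theorem then puts the average inside.\<close>

lemma integral_average_rotations:
  fixes M :: "'x::second_countable_topology measure" and F :: "'x \<times> complex \<Rightarrow> real"
  assumes M: "prob_space M" "sets M = sets borel"
    and F: "continuous_on UNIV F" "\<And>y. \<bar>F y\<bar> \<le> 1"
    and I: "\<And>b. cmod b = 1 \<Longrightarrow> (\<integral>x. F (x, b) \<partial>M) = I"
  shows "I = (\<integral>x. (\<integral>b. F (x, b) \<partial>circle_measure) \<partial>M)"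
proof -
  interpret u: prob_space circle_measure by (rule prob_space_circle_measure)
  have "(\<integral>b. (\<integral>x. F (x, b) \<partial>M) \<partial>circle_measure) = (\<integral>b. I \<partial>circle_measure)"
  proof (rule Bochner_Integration.integral_cong_AE)
    show "(\<lambda>b. \<integral>x. F (x, b) \<partial>M) \<in> borel_measurable circle_measure"
    proof -
      interpret M: prob_space M by fact
      interpret pair_prob_space M circle_measure ..
      have "sets (circle_measure \<Otimes>\<^sub>M M) = sets (borel \<Otimes>\<^sub>M borel :: (complex \<times> 'x) measure)"
        by (rule sets_pair_measure_cong[OF sets_circle_measure M(2)])
      then have sets: "sets (circle_measure \<Otimes>\<^sub>M M) = sets (borel :: (complex \<times> 'x) measure)"
        by (simp only: borel_prod)
      have "continuous_on UNIV (\<lambda>y :: complex \<times> 'x. F (snd y, fst y))"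
        by (rule continuous_on_compose2[OF F(1)]) (auto intro!: continuous_intros)
      then have "(\<lambda>y :: complex \<times> 'x. F (snd y, fst y)) \<in> borel_measurable (circle_measure \<Otimes>\<^sub>M M)"
        using borel_measurable_continuous_onI measurable_cong_sets[OF sets refl] by blast
      then have "(\<lambda>(b, x). F (x, b)) \<in> borel_measurable (circle_measure \<Otimes>\<^sub>M M)"
        by (simp add: case_prod_beta)
      then show ?thesis by (rule M.borel_measurable_lebesgue_integral)
    qed
    show "AE b in circle_measure. (\<integral>x. F (x, b) \<partial>M) = I"
      using AE_circle_measure by eventually_elim (rule I)
  qed simp
  then show ?thesis using Fubini_circle_measure(1)[OF M F] u.prob_space by simp
qed

section \<open>A characterisation of Haar measure on the torus\<close>

definition torus_measure :: "(complex \<times> complex) measure" where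
  "torus_measure = circle_measure \<Otimes>\<^sub>M circle_measure"

text \<open>The two invariances differ in strength on purpose. A skew product commutes with vertical
  rotations but in general not with horizontal ones, so for the latter only the marginal on the
  first circle is within reach; this weaker form still determines the measure.\<close>

definition rotation_invariant_on_torus :: "(complex \<times> complex) measure \<Rightarrow> bool" where
  "rotation_invariant_on_torus M \<longleftrightarrow>
     prob_space M \<and> sets M = sets borel \<and> (AE x in M. x \<in> torus) \<and>
     (\<forall>f :: complex \<times> complex \<Rightarrow> real. \<forall>\<beta>. continuous_on UNIV f \<longrightarrow> (\<forall>x. \<bar>f x\<bar> \<le> 1) \<longrightarrow> cmod \<beta> = 1 \<longrightarrow>
        (\<integral>x. f (fst x, \<beta> * snd x) \<partial>M) = (\<integral>x. f x \<partial>M)) \<and>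
     (\<forall>g :: complex \<Rightarrow> real. \<forall>\<alpha>. continuous_on UNIV g \<longrightarrow> (\<forall>x. \<bar>g x\<bar> \<le> 1) \<longrightarrow> cmod \<alpha> = 1 \<longrightarrow>
        (\<integral>x. g (\<alpha> * fst x) \<partial>M) = (\<integral>x. g (fst x) \<partial>M))"

lemma sets_torus_measure: "sets torus_measure = sets borel"
proof -
  have "sets torus_measure = sets (borel \<Otimes>\<^sub>M borel :: (complex \<times> complex) measure)"
    unfolding torus_measure_def by (rule sets_pair_measure_cong) simp_all
  then show ?thesis by (simp only: borel_prod)
qed

lemma prob_space_torus_measure: "prob_space torus_measure"
proof -
  interpret u: prob_space circle_measure by (rule prob_space_circle_measure)
  interpret pair_prob_space circle_measure circle_measure ..
  show ?thesis unfolding torus_measure_def by (rule P.prob_space_axioms)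
qed

lemma AE_torus_measure: "AE x in torus_measure. x \<in> torus"
proof -
  interpret u: prob_space circle_measure by (rule prob_space_circle_measure)
  interpret pair_prob_space circle_measure circle_measure ..
  have "{x. x \<in> torus} \<in> sets (borel :: (complex \<times> complex) measure)"
    using borel_closed[OF compact_imp_closed[OF compact_torus]] by simp
  then have s: "{x \<in> space (circle_measure \<Otimes>\<^sub>M circle_measure). x \<in> torus} \<in> sets (circle_measure \<Otimes>\<^sub>M circle_measure)"
    using sets_torus_measure sets_eq_imp_space_eq[OF sets_torus_measure] unfolding torus_measure_def by simp
  have "AE z in circle_measure. AE w in circle_measure. (z, w) \<in> torus"
    using AE_circle_measure
  proof eventually_elim
    case (elim z)
    show ?case using AE_circle_measure by eventually_elim (use elim in simp)
  qed
  then show ?thesis unfolding torus_measure_def by (rule AE_pair_measure[OF s])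
qed

text \<open>Averaging over vertical rotations replaces f by its mean over each vertical circle. This
  mean depends on the first coordinate only, so that invariance of the marginal is enough to average
  it too.\<close>

lemma rotation_invariant_integral:
  fixes f :: "complex \<times> complex \<Rightarrow> real"
  assumes M: "rotation_invariant_on_torus M" and f: "continuous_on UNIV f" "\<And>x. \<bar>f x\<bar> \<le> 1"
  shows "(\<integral>x. f x \<partial>M) = (\<integral>b. (\<integral>a. f (a, b) \<partial>circle_measure) \<partial>circle_measure)"
proof -
  have p: "prob_space M" and s: "sets M = sets borel" and t: "AE x in M. x \<in> torus"
    and V: "\<And>(f :: complex \<times> complex \<Rightarrow> real) \<beta>. continuous_on UNIV f \<Longrightarrow> (\<And>x. \<bar>f x\<bar> \<le> 1) \<Longrightarrow> cmod \<beta> = 1 \<Longrightarrow>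
        (\<integral>x. f (fst x, \<beta> * snd x) \<partial>M) = (\<integral>x. f x \<partial>M)"
    and H: "\<And>(g :: complex \<Rightarrow> real) \<alpha>. continuous_on UNIV g \<Longrightarrow> (\<And>x. \<bar>g x\<bar> \<le> 1) \<Longrightarrow> cmod \<alpha> = 1 \<Longrightarrow>
        (\<integral>x. g (\<alpha> * fst x) \<partial>M) = (\<integral>x. g (fst x) \<partial>M)"
    using M unfolding rotation_invariant_on_torus_def by blast+
  interpret M: prob_space M by (rule p)
  have slice: "continuous_on UNIV (\<lambda>w. f (z, w))" "continuous_on UNIV (\<lambda>z. f (z, w))" for z w
    by (rule continuous_on_compose2[OF f(1)]; auto intro!: continuous_intros)+
  let ?F = "\<lambda>y :: (complex \<times> complex) \<times> complex. f (fst (fst y), snd y * snd (fst y))"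
  let ?G = "\<lambda>y :: (complex \<times> complex) \<times> complex. f (fst (fst y), snd y)"
  have F: "continuous_on UNIV ?F" and G: "continuous_on UNIV ?G"
    by (rule continuous_on_compose2[OF f(1)]; auto intro!: continuous_intros)+
  have meas: "(\<lambda>x. \<integral>b. F (x, b) \<partial>circle_measure) \<in> borel_measurable M"
    if "continuous_on UNIV F" for F :: "(complex \<times> complex) \<times> complex \<Rightarrow> real"
  proof -
    interpret u: prob_space circle_measure by (rule prob_space_circle_measure)
    interpret pair_prob_space M circle_measure ..
    have "sets (M \<Otimes>\<^sub>M circle_measure) = sets (borel \<Otimes>\<^sub>M borel :: ((complex \<times> complex) \<times> complex) measure)"
      by (rule sets_pair_measure_cong[OF s sets_circle_measure])
    then have sets: "sets (M \<Otimes>\<^sub>M circle_measure) = sets (borel :: ((complex \<times> complex) \<times> complex) measure)"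
      by (simp only: borel_prod)
    have "F \<in> borel_measurable (M \<Otimes>\<^sub>M circle_measure)"
      using borel_measurable_continuous_onI[OF that] measurable_cong_sets[OF sets refl] by blast
    then have "(\<lambda>(x, b). F (x, b)) \<in> borel_measurable (M \<Otimes>\<^sub>M circle_measure)"
      by (simp add: case_prod_beta)
    then show ?thesis by (rule u.borel_measurable_lebesgue_integral)
  qed
  have "(\<integral>x. f x \<partial>M) = (\<integral>x. (\<integral>b. ?F (x, b) \<partial>circle_measure) \<partial>M)"
    by (rule integral_average_rotations[OF p s F]) (use f V in auto)
  \<comment> \<open>The second coordinate is almost surely unimodular, so rotation invariance of
    \<open>circle_measure\<close> absorbs it.\<close>
  also have "\<dots> = (\<integral>x. (\<integral>b. ?G (x, b) \<partial>circle_measure) \<partial>M)"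
  proof (rule Bochner_Integration.integral_cong_AE)
    show "AE x in M. (\<integral>b. ?F (x, b) \<partial>circle_measure) = (\<integral>b. ?G (x, b) \<partial>circle_measure)"
      using t
    proof eventually_elim
      case (elim x)
      then have "cmod (snd x) = 1" by auto
      from integral_circle_measure_rotate[OF slice(1) this, of "fst x"]
      show ?case by (simp add: mult.commute)
    qed
  qed (rule meas[OF F], rule meas[OF G])
  also have "\<dots> = (\<integral>b. (\<integral>x. ?G (x, b) \<partial>M) \<partial>circle_measure)"
    by (rule Fubini_circle_measure(1)[OF p s G, symmetric]) (use f in auto)
  also have "(\<lambda>b. \<integral>x. ?G (x, b) \<partial>M) = (\<lambda>b. \<integral>a. f (a, b) \<partial>circle_measure)"
  proof
    fix b
    let ?K = "\<lambda>y :: (complex \<times> complex) \<times> complex. f (snd y * fst (fst y), b)"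
    have K: "continuous_on UNIV ?K"
      by (rule continuous_on_compose2[OF f(1)]) (auto intro!: continuous_intros)
    have "(\<integral>x. ?G (x, b) \<partial>M) = (\<integral>x. (\<integral>a. ?K (x, a) \<partial>circle_measure) \<partial>M)"
    proof (rule integral_average_rotations[OF p s K])
      show "(\<integral>x. ?K (x, a) \<partial>M) = (\<integral>x. ?G (x, b) \<partial>M)" if "cmod a = 1" for a
        using H[OF slice(2) _ that, of b] f(2) by simp
    qed (use f in auto)
    also have "\<dots> = (\<integral>x. (\<integral>a. f (a, b) \<partial>circle_measure) \<partial>M)"
    proof (rule Bochner_Integration.integral_cong_AE)
      show "AE x in M. (\<integral>a. ?K (x, a) \<partial>circle_measure) = (\<integral>a. f (a, b) \<partial>circle_measure)"
        using t
      proof eventually_elim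
        case (elim x)
        then have "cmod (fst x) = 1" by auto
        from integral_circle_measure_rotate[OF slice(2) this, of b]
        show ?case by (simp add: mult.commute)
      qed
    qed (rule meas[OF K], simp)
    finally show "(\<integral>x. ?G (x, b) \<partial>M) = (\<integral>a. f (a, b) \<partial>circle_measure)"
      by (simp add: M.prob_space)
  qed
  finally show ?thesis .
qed

lemma rotation_invariant_torus_measure: "rotation_invariant_on_torus torus_measure"
  unfolding rotation_invariant_on_torus_def
proof (intro conjI allI impI)
  have int: "(\<integral>y. F y \<partial>torus_measure) = (\<integral>x. (\<integral>b. F (x, b) \<partial>circle_measure) \<partial>circle_measure)"
    if "continuous_on UNIV F" "\<And>y. \<bar>F y\<bar> \<le> 1" for F :: "complex \<times> complex \<Rightarrow> real"
    unfolding torus_measure_def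
    using Fubini_circle_measure(2)[OF prob_space_circle_measure sets_circle_measure that] .
  show "(\<integral>x. f (fst x, \<beta> * snd x) \<partial>torus_measure) = (\<integral>x. f x \<partial>torus_measure)"
    if f: "continuous_on UNIV f" "\<forall>x. \<bar>f x\<bar> \<le> 1" and b: "cmod \<beta> = 1" for f :: "complex \<times> complex \<Rightarrow> real" and \<beta>
  proof -
    have c: "continuous_on UNIV (\<lambda>x. f (fst x, \<beta> * snd x))"
      by (rule continuous_on_compose2[OF f(1)]) (auto intro!: continuous_intros)
    have sl: "continuous_on UNIV (\<lambda>w. f (z, w))" for z
      by (rule continuous_on_compose2[OF f(1)]) (auto intro!: continuous_intros)
    have "(\<integral>x. f (fst x, \<beta> * snd x) \<partial>torus_measure) = (\<integral>z. (\<integral>w. f (z, \<beta> * w) \<partial>circle_measure) \<partial>circle_measure)"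
      using int[OF c] f(2) by simp
    also have "\<dots> = (\<integral>z. (\<integral>w. f (z, w) \<partial>circle_measure) \<partial>circle_measure)"
      by (simp only: integral_circle_measure_rotate[OF sl b])
    also have "\<dots> = (\<integral>x. f x \<partial>torus_measure)" using int[OF f(1)] f(2) by simp
    finally show ?thesis .
  qed
  show "(\<integral>x. g (\<alpha> * fst x) \<partial>torus_measure) = (\<integral>x. g (fst x) \<partial>torus_measure)"
    if g: "continuous_on UNIV g" "\<forall>x. \<bar>g x\<bar> \<le> 1" and a: "cmod \<alpha> = 1" for g :: "complex \<Rightarrow> real" and \<alpha>
  proof -
    have c: "continuous_on UNIV (\<lambda>x :: complex \<times> complex. g (\<alpha> * fst x))" "continuous_on UNIV (\<lambda>x :: complex \<times> complex. g (fst x))"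
      by (rule continuous_on_compose2[OF g(1)]; auto intro!: continuous_intros)+
    interpret u: prob_space circle_measure by (rule prob_space_circle_measure)
    have "(\<integral>x. g (\<alpha> * fst x) \<partial>torus_measure) = (\<integral>z. g (\<alpha> * z) \<partial>circle_measure)"
      using int[OF c(1)] g(2) u.prob_space by simp
    also have "\<dots> = (\<integral>z. g z \<partial>circle_measure)" by (rule integral_circle_measure_rotate[OF g(1) a])
    also have "\<dots> = (\<integral>x. g (fst x) \<partial>torus_measure)" using int[OF c(2)] g(2) u.prob_space by simp
    finally show ?thesis .
  qed
qed (simp_all add: prob_space_torus_measure sets_torus_measure AE_torus_measure)

lemma rotation_invariant_eq_torus_measure:
  assumes "rotation_invariant_on_torus M"
  shows "M = torus_measure"
proof (rule measure_eqI_continuous)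
  show "prob_space M" "sets M = sets borel"
    using assms unfolding rotation_invariant_on_torus_def by auto
qed (simp_all add: prob_space_torus_measure sets_torus_measure rotation_invariant_integral[OF assms]
    rotation_invariant_integral[OF rotation_invariant_torus_measure])

section \<open>Invariant measures of skew products\<close>

lemma continuous_on_skew_power: "continuous_on S (skew p ^^ n)"
  using continuous_on_skew_funpow[of S "\<lambda>_. p" "\<lambda>x. x" n] by simp

lemma skew_power_in_torus:
  assumes "cmod (fst p) = 1" "\<And>z. cmod (apply_bcontfun (snd p) z) = 1" "x \<in> torus"
  shows "(skew p ^^ n) x \<in> torus"
  using assms by (induction n) (auto simp: skew_def norm_mult mem_Times_iff)

lemma skew_vertical_rotation: "skew p (fst x, \<beta> * snd x) = (fst (skew p x), \<beta> * snd (skew p x))"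
  by (simp add: skew_def mult_ac)

text \<open>The image measure inherits rotation invariance, because the skew product commutes with
  vertical rotations and rotates the base; uniqueness then identifies it.\<close>

lemma distr_torus_measure_skew:
  assumes a: "cmod (fst p) = 1" and g: "\<And>z. cmod (apply_bcontfun (snd p) z) = 1"
  shows "distr torus_measure borel (skew p) = torus_measure"
proof (rule rotation_invariant_eq_torus_measure)
  let ?N = "distr torus_measure borel (skew p)"
  have cont: "continuous_on UNIV (skew p)" using continuous_on_skew_power[of UNIV 1 p] by simp
  have meas: "skew p \<in> measurable torus_measure borel"
    using borel_measurable_continuous_onI[OF cont] measurable_cong_sets[OF sets_torus_measure refl] by blast
  have int: "(\<integral>x. f x \<partial>?N) = (\<integral>x. f (skew p x) \<partial>torus_measure)" if "continuous_on UNIV f"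
    for f :: "complex \<times> complex \<Rightarrow> real"
    by (rule integral_distr[OF meas]) (rule borel_measurable_continuous_onI[OF that])
  note R = rotation_invariant_torus_measure[unfolded rotation_invariant_on_torus_def]
  show "rotation_invariant_on_torus ?N"
    unfolding rotation_invariant_on_torus_def
  proof (intro conjI allI impI)
    show "prob_space ?N" by (rule prob_space.prob_space_distr[OF prob_space_torus_measure meas])
    have "AE x in torus_measure. skew p x \<in> torus"
      using AE_torus_measure by eventually_elim (use skew_power_in_torus[OF a g, of _ 1] in simp)
    moreover have "{x \<in> space borel. x \<in> torus} \<in> sets (borel :: (complex \<times> complex) measure)"
      using borel_closed[OF compact_imp_closed[OF compact_torus]] by simp
    ultimately show "AE x in ?N. x \<in> torus" by (simp only: AE_distr_iff[OF meas])
    show "(\<integral>x. f (fst x, \<beta> * snd x) \<partial>?N) = (\<integral>x. f x \<partial>?N)"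
      if f: "continuous_on UNIV f" "\<forall>x. \<bar>f x\<bar> \<le> 1" and b: "cmod \<beta> = 1" for f :: "complex \<times> complex \<Rightarrow> real" and \<beta>
    proof -
      have c: "continuous_on UNIV (\<lambda>x. f (fst x, \<beta> * snd x))"
        by (rule continuous_on_compose2[OF f(1)]) (auto intro!: continuous_intros)
      have c2: "continuous_on UNIV (\<lambda>x. f (skew p x))"
        by (rule continuous_on_compose2[OF f(1) cont]) simp
      have "(\<integral>x. f (fst x, \<beta> * snd x) \<partial>?N) = (\<integral>x. f (skew p (fst x, \<beta> * snd x)) \<partial>torus_measure)"
        unfolding int[OF c] by (simp add: skew_vertical_rotation)
      also have "\<dots> = (\<integral>x. f (skew p x) \<partial>torus_measure)"
        using R c2 f(2) b by blast
      finally show ?thesis unfolding int[OF f(1)] .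
    qed
    show "(\<integral>x. g (\<alpha> * fst x) \<partial>?N) = (\<integral>x. g (fst x) \<partial>?N)"
      if g: "continuous_on UNIV g" "\<forall>x. \<bar>g x\<bar> \<le> 1" and al: "cmod \<alpha> = 1" for g :: "complex \<Rightarrow> real" and \<alpha>
    proof -
      have c: "continuous_on UNIV (\<lambda>x :: complex \<times> complex. g (\<alpha> * fst x))" "continuous_on UNIV (\<lambda>x :: complex \<times> complex. g (fst x))"
        by (rule continuous_on_compose2[OF g(1)]; auto intro!: continuous_intros)+
      have H: "(\<integral>x. g (\<alpha> * fst x) \<partial>torus_measure) = (\<integral>x. g (fst x) \<partial>torus_measure)" if "cmod \<alpha> = 1" for \<alpha>
        using R g that by blast
      have "(\<integral>x. g (\<alpha> * fst x) \<partial>?N) = (\<integral>x. g ((\<alpha> * fst p) * fst x) \<partial>torus_measure)"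
        unfolding int[OF c(1)] by (simp add: skew_def mult.assoc)
      also have "\<dots> = (\<integral>x. g (fst p * fst x) \<partial>torus_measure)"
        using H[of "\<alpha> * fst p"] H[of "fst p"] al a by (simp add: norm_mult)
      finally show ?thesis unfolding int[OF c(2)] by (simp add: skew_def)
    qed
  qed simp
qed


text \<open>
  An invariant measure is also invariant under uniform limits of powers, here the vertical
  rotations, and its marginal on the first circle under the limits of powers of the base rotation.
\<close>

lemma invariant_measure_eq_torus_measure:
  assumes a: "cmod (fst p) = 1" and g: "\<And>z. cmod (apply_bcontfun (snd p) z) = 1"
    and vert: "\<And>\<beta> e. cmod \<beta> = 1 \<Longrightarrow> e > 0 \<Longrightarrow>
      \<exists>n. \<forall>x\<in>torus. dist ((skew p ^^ (m * n)) x) (fst x, \<beta> * snd x) < e"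
    and hor: "\<And>\<alpha> e. cmod \<alpha> = 1 \<Longrightarrow> e > 0 \<Longrightarrow> \<exists>n. dist (fst p ^ (m * n)) \<alpha> < e"
    and M: "prob_space M" "sets M = sets borel" "AE x in M. x \<in> torus"
    and inv: "distr M borel (skew p ^^ m) = M"
  shows "M = torus_measure"
proof (rule rotation_invariant_eq_torus_measure)
  interpret M: prob_space M by fact
  have measM: "f \<in> measurable M borel" if "continuous_on UNIV f" for f :: "complex \<times> complex \<Rightarrow> 'b::topological_space"
    using borel_measurable_continuous_onI[OF that] measurable_cong_sets[OF M(2) refl] by blast
  have inv_int: "(\<integral>x. f ((skew p ^^ (m * n)) x) \<partial>M) = (\<integral>x. f x \<partial>M)" if f: "continuous_on UNIV f"
    for f :: "complex \<times> complex \<Rightarrow> real" and n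
  proof (induction n)
    case (Suc n)
    have c: "continuous_on UNIV (\<lambda>x. f ((skew p ^^ (m * n)) x))"
      by (rule continuous_on_compose2[OF f continuous_on_skew_power]) simp
    have "(\<integral>x. f ((skew p ^^ (m * n)) x) \<partial>distr M borel (skew p ^^ m)) = (\<integral>x. f ((skew p ^^ (m * n)) ((skew p ^^ m) x)) \<partial>M)"
      by (rule integral_distr[OF measM[OF continuous_on_skew_power] borel_measurable_continuous_onI[OF c]])
    moreover have "(skew p ^^ (m * n)) ((skew p ^^ m) x) = (skew p ^^ (m * Suc n)) x" for x
      by (simp add: funpow_add add.commute[of m])
    ultimately show ?case using Suc inv by simp
  qed simp
  have limit: "(\<integral>x. f (R x) \<partial>M) = (\<integral>x. f x \<partial>M)"
    if f: "continuous_on UNIV f" "\<forall>x. \<bar>f x\<bar> \<le> 1" and R: "continuous_on UNIV R"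
      and lim: "\<And>x. x \<in> torus \<Longrightarrow> (\<lambda>k. f ((skew p ^^ (m * n k)) x)) \<longlonglongrightarrow> f (R x)"
    for f :: "complex \<times> complex \<Rightarrow> real" and R and n :: "nat \<Rightarrow> nat"
  proof -
    have "(\<lambda>k. \<integral>x. f ((skew p ^^ (m * n k)) x) \<partial>M) \<longlonglongrightarrow> (\<integral>x. f (R x) \<partial>M)"
    proof (rule integral_dominated_convergence[where w = "\<lambda>_. 1"])
      show "(\<lambda>x. f (R x)) \<in> borel_measurable M"
        by (rule measM, rule continuous_on_compose2[OF f(1) R]) simp
      show "(\<lambda>x. f ((skew p ^^ (m * n k)) x)) \<in> borel_measurable M" for k
        by (rule measM, rule continuous_on_compose2[OF f(1) continuous_on_skew_power]) simp
      show "AE x in M. (\<lambda>k. f ((skew p ^^ (m * n k)) x)) \<longlonglongrightarrow> f (R x)"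
        using M(3) by eventually_elim (rule lim)
      show "AE x in M. norm (f ((skew p ^^ (m * n k)) x)) \<le> 1" for k
        using f(2) by (simp del: split_paired_All)
    qed simp
    then show ?thesis unfolding inv_int[OF f(1)] by (simp add: LIMSEQ_const_iff)
  qed
  show "rotation_invariant_on_torus M"
    unfolding rotation_invariant_on_torus_def
  proof (intro conjI allI impI M)
    show "(\<integral>x. f (fst x, \<beta> * snd x) \<partial>M) = (\<integral>x. f x \<partial>M)"
      if f: "continuous_on UNIV f" "\<forall>x. \<bar>f x\<bar> \<le> 1" and b: "cmod \<beta> = 1" for f :: "complex \<times> complex \<Rightarrow> real" and \<beta>
    proof -
      have "\<forall>k. \<exists>n. \<forall>x\<in>torus. dist ((skew p ^^ (m * n)) x) (fst x, \<beta> * snd x) < inverse (real (Suc k))"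
        using vert[OF b] by simp
      then obtain n where n: "\<And>k x. x \<in> torus \<Longrightarrow>
          dist ((skew p ^^ (m * n k)) x) (fst x, \<beta> * snd x) < inverse (real (Suc k))"
        by metis
      show ?thesis
      proof (rule limit[OF f, of "\<lambda>x. (fst x, \<beta> * snd x)" n])
        fix x assume x: "x \<in> torus"
        have "(\<lambda>k. dist ((skew p ^^ (m * n k)) x) (fst x, \<beta> * snd x)) \<longlonglongrightarrow> 0"
          by (rule Lim_null_comparison[OF always_eventually LIMSEQ_inverse_real_of_nat])
            (use n[OF x] in \<open>simp add: less_imp_le\<close>)
        then have "(\<lambda>k. (skew p ^^ (m * n k)) x) \<longlonglongrightarrow> (fst x, \<beta> * snd x)"
          by (rule tendsto_dist_iff[THEN iffD2])
        moreover have "isCont f (fst x, \<beta> * snd x)"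
          using continuous_on_eq_continuous_at[OF open_UNIV] f(1) by blast
        ultimately show "(\<lambda>k. f ((skew p ^^ (m * n k)) x)) \<longlonglongrightarrow> f (fst x, \<beta> * snd x)"
          by (rule isCont_tendsto_compose[rotated])
      qed (intro continuous_intros)
    qed
    show "(\<integral>x. g (\<alpha> * fst x) \<partial>M) = (\<integral>x. g (fst x) \<partial>M)"
      if g: "continuous_on UNIV g" "\<forall>x. \<bar>g x\<bar> \<le> 1" and al: "cmod \<alpha> = 1" for g :: "complex \<Rightarrow> real" and \<alpha>
    proof -
      have "\<forall>k. \<exists>n. dist (fst p ^ (m * n)) \<alpha> < inverse (real (Suc k))"
        using hor[OF al] by simp
      then obtain n where n: "\<And>k. dist (fst p ^ (m * n k)) \<alpha> < inverse (real (Suc k))"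
        by metis
      have "(\<lambda>k. dist (fst p ^ (m * n k)) \<alpha>) \<longlonglongrightarrow> 0"
        by (rule Lim_null_comparison[OF always_eventually LIMSEQ_inverse_real_of_nat])
          (use n in \<open>simp add: less_imp_le\<close>)
      then have lim: "(\<lambda>k. fst p ^ (m * n k)) \<longlonglongrightarrow> \<alpha>"
        by (rule tendsto_dist_iff[THEN iffD2])
      have c: "continuous_on UNIV (\<lambda>x :: complex \<times> complex. g (fst x))"
        by (rule continuous_on_compose2[OF g(1)]) (auto intro!: continuous_intros)
      \<comment> \<open>The powers of the skew product need not converge to this horizontal
        rotation; \<open>limit\<close> asks only for convergence of the integrand, which sees the
        first coordinate alone.\<close>
      have "(\<integral>x. g (fst (\<alpha> * fst x, snd x)) \<partial>M) = (\<integral>x. g (fst x) \<partial>M)"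
      proof (rule limit[OF c, of "\<lambda>x. (\<alpha> * fst x, snd x)" n])
        fix x :: "complex \<times> complex"
        have "isCont g (\<alpha> * fst x)"
          using continuous_on_eq_continuous_at[OF open_UNIV] g(1) by blast
        moreover have "(\<lambda>k. fst p ^ (m * n k) * fst x) \<longlonglongrightarrow> \<alpha> * fst x"
          by (intro tendsto_mult lim tendsto_const)
        ultimately have "(\<lambda>k. g (fst p ^ (m * n k) * fst x)) \<longlonglongrightarrow> g (\<alpha> * fst x)"
          by (rule isCont_tendsto_compose)
        then show "(\<lambda>k. g (fst ((skew p ^^ (m * n k)) x))) \<longlonglongrightarrow> g (fst (\<alpha> * fst x, snd x))"
          by simp
      next
        show "\<forall>x. \<bar>g (fst x)\<bar> \<le> 1" using g(2) by simp
      qed (intro continuous_intros)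
      then show ?thesis by simp
    qed
  qed
qed

section \<open>A generic skew product\<close>

lemma ex_generic_skew:
  fixes C :: nat and h1 h2 :: "nat \<Rightarrow> real"
  assumes C: "C \<ge> 2" and h1: "\<And>n. n > 0 \<Longrightarrow> h1 n > 0" and h2: "filterlim h2 at_top sequentially"
  obtains p where "cmod (fst p) = 1" "\<And>z. cmod (apply_bcontfun (snd p) z) = 1"
    "\<And>N. \<exists>q. prime q \<and> (\<forall>x\<in>torus. dist ((skew p ^^ q) x) x < h1 q / real (Suc N))"
    "\<And>m \<beta> e. m > 0 \<Longrightarrow> cmod \<beta> = 1 \<Longrightarrow> e > 0 \<Longrightarrow>
      \<exists>n. \<forall>x\<in>torus. dist ((skew p ^^ (m * n)) x) (fst x, \<beta> * snd x) < e"
    "\<And>m \<alpha> e. m > 0 \<Longrightarrow> cmod \<alpha> = 1 \<Longrightarrow> e > 0 \<Longrightarrow> \<exists>n. dist (fst p ^ (m * n)) \<alpha> < e"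
    "\<And>N c. c \<in> {1, -1} \<Longrightarrow> \<exists>r>N. squarefree r \<and> (\<forall>p. prime p \<and> p dvd r \<longrightarrow> p > N) \<and>
      real (num_prime_divisors r) < h2 r \<and> cmod (power_average C r p - c) < 1 / 2"
proof -
  \<comment> \<open>Rational angles give countably many rotations, dense in the circle, which keeps
    the family of open sets countable.\<close>
  define rot :: "rat \<Rightarrow> complex" where "rot \<rho> = cis (of_rat \<rho>)" for \<rho>
  have rot_unit: "cmod (rot \<rho>) = 1" for \<rho> by (simp add: rot_def)
  define R :: "rat \<Rightarrow> complex \<times> complex \<Rightarrow> complex \<times> complex" where "R \<rho> x = (fst x, rot \<rho> * snd x)" for \<rho> x
  \<comment> \<open>The factor 1 / (N + 1), imposed for all N, later yields little-o and not merely
    big-O.\<close>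
  define A1 where "A1 N = (\<Union>q\<in>{q. prime q}. close_to_on_torus (h1 q / real (Suc N)) q (\<lambda>x. x))" for N
  define A2 where "A2 m \<rho> N = (\<Union>n. close_to_on_torus (1 / real (Suc N)) (Suc m * n) (R \<rho>))" for m \<rho> N
  define A3 where "A3 m \<rho> N = (\<Union>n. {p :: complex \<times> (complex \<Rightarrow>\<^sub>C complex).
      dist (fst p ^ (Suc m * n)) (rot \<rho>) < 1 / real (Suc N)})" for m \<rho> N
  define good where "good N r \<longleftrightarrow> r > N \<and> squarefree r \<and> (\<forall>p. prime p \<and> p dvd r \<longrightarrow> p > N) \<and>
      real (num_prime_divisors r) < h2 r" for N r
  define A4 where "A4 N c = (\<Union>r\<in>{r. good N r}. {p. cmod (power_average C r p - c) < 1 / 2})" for N and c :: complex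
  define \<U> where "\<U> = range A1 \<union> (\<Union>m. \<Union>\<rho>. range (A2 m \<rho>)) \<union> (\<Union>m. \<Union>\<rho>. range (A3 m \<rho>))
      \<union> (\<Union>c\<in>{1, -1}. range (\<lambda>N. A4 N c))"
  have count: "countable \<U>" unfolding \<U>_def
    by (intro countable_Un countable_UN countable_image) auto
  have ne: "coboundaries \<noteq> {}"
    using cob_in_coboundaries[of 1 1 "\<lambda>_. 0"] admissible_zero by auto
  have R_cont: "continuous_on UNIV (R \<rho>)" for \<rho> unfolding R_def by (intro continuous_intros)
  have op: "open U" if "U \<in> \<U>" for U
  proof -
    have "open (A1 N)" for N unfolding A1_def by (intro open_UN ballI open_close_to_on_torus continuous_intros)
    moreover have "open (A2 m \<rho> N)" for m \<rho> N unfolding A2_def by (intro open_UN ballI open_close_to_on_torus R_cont)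
    moreover have "open (A3 m \<rho> N)" for m \<rho> N unfolding A3_def
      by (intro open_UN ballI open_Collect_less continuous_intros)
    moreover have "open (A4 N c)" for N c unfolding A4_def
      by (intro open_UN ballI open_Collect_less continuous_intros continuous_on_power_average)
    ultimately show ?thesis using that unfolding \<U>_def by blast
  qed
  \<comment> \<open>For \<open>\<alpha>\<close> = 1 the coboundary phase cancels and the n-th
    iterate is an exact vertical rotation; for other targets only the base rotation is
    prescribed.\<close>
  have power: "\<exists>n0. \<forall>n\<ge>n0. \<forall>\<alpha> \<beta>. cmod \<alpha> = 1 \<longrightarrow> cmod \<beta> = 1 \<longrightarrow>
     (\<exists>q\<in>coboundaries. dist q p < e \<and> fst q ^ n = \<alpha> \<and> (\<alpha> = 1 \<longrightarrow> (\<forall>x. (skew q ^^ n) x = (fst x, \<beta> * snd x))))"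
    if pe: "p \<in> coboundaries" "e > 0" for p e
  proof -
    obtain n0 where n0: "\<And>n \<alpha> \<beta>. n \<ge> n0 \<Longrightarrow> cmod \<alpha> = 1 \<Longrightarrow> cmod \<beta> = 1 \<Longrightarrow>
       \<exists>a b G. cmod a = 1 \<and> cmod b = 1 \<and> admissible G \<and> dist (cob a b G) p < e \<and> a ^ n = \<alpha> \<and> b ^ n = \<beta>"
      using dense_coboundaries_power[OF pe] by blast
    show ?thesis
    proof (intro exI[of _ n0] allI impI)
      fix n \<alpha> \<beta> assume n: "n \<ge> n0" and u: "cmod \<alpha> = 1" "cmod \<beta> = 1"
      obtain a b G where abG: "cmod a = 1" "cmod b = 1" "admissible G" "dist (cob a b G) p < e" "a ^ n = \<alpha>" "b ^ n = \<beta>"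
        using n0[OF n u] by blast
      have "(skew (cob a b G) ^^ n) x = (fst x, \<beta> * snd x)" if "\<alpha> = 1" for x
        using skew_funpow_cob[OF abG(3), where a = a and b = b and n = n and z = "fst x" and w = "snd x"] abG(5,6) that by (simp add: mult.commute)
      then show "\<exists>q\<in>coboundaries. dist q p < e \<and> fst q ^ n = \<alpha> \<and> (\<alpha> = 1 \<longrightarrow> (\<forall>x. (skew q ^^ n) x = (fst x, \<beta> * snd x)))"
        using cob_in_coboundaries[OF abG(1-3)] abG(4,5) by (intro bexI[of _ "cob a b G"]) auto
    qed
  qed
  have dense: "\<exists>q\<in>coboundaries \<inter> U. dist q p < e" if U: "U \<in> \<U>" and p: "p \<in> coboundaries" and e: "e > 0" for U p e
  proof -
    obtain n0 where n0: "\<And>n \<alpha> \<beta>. n \<ge> n0 \<Longrightarrow> cmod \<alpha> = 1 \<Longrightarrow> cmod \<beta> = 1 \<Longrightarrow>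
       \<exists>q\<in>coboundaries. dist q p < e \<and> fst q ^ n = \<alpha> \<and> (\<alpha> = 1 \<longrightarrow> (\<forall>x. (skew q ^^ n) x = (fst x, \<beta> * snd x)))"
      using power[OF p e] by blast
    have "(\<exists>N. U = A1 N) \<or> (\<exists>m \<rho> N. U = A2 m \<rho> N) \<or> (\<exists>m \<rho> N. U = A3 m \<rho> N) \<or> (\<exists>N. \<exists>c\<in>{1, -1}. U = A4 N c)"
      using U unfolding \<U>_def by blast
    then consider N where "U = A1 N" | m \<rho> N where "U = A2 m \<rho> N" | m \<rho> N where "U = A3 m \<rho> N"
      | N c where "U = A4 N c" "c \<in> {1, -1}"
      by blast
    then show ?thesis
    proof cases
      case (1 N)
      obtain k :: nat where k: "prime k" "k > n0" using bigger_prime by blast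
      obtain q where q: "q \<in> coboundaries" "dist q p < e" "\<And>x. (skew q ^^ k) x = (fst x, 1 * snd x)"
        using n0[of k 1 1] k by auto
      have "h1 k / real (Suc N) > 0" using h1[of k] k by simp
      then have "q \<in> close_to_on_torus (h1 k / real (Suc N)) k (\<lambda>x. x)"
        unfolding close_to_on_torus_def using q(3) by simp
      then have "q \<in> A1 N" unfolding A1_def using k(1) by blast
      then show ?thesis using q 1 by blast
    next
      case (2 m \<rho> N)
      obtain q where q: "q \<in> coboundaries" "dist q p < e" "\<And>x. (skew q ^^ (Suc m * n0)) x = (fst x, rot \<rho> * snd x)"
        using n0[of "Suc m * n0" 1 "rot \<rho>"] rot_unit by auto
      then have "q \<in> close_to_on_torus (1 / real (Suc N)) (Suc m * n0) (R \<rho>)"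
        unfolding close_to_on_torus_def R_def by simp
      then have "q \<in> A2 m \<rho> N" unfolding A2_def by blast
      then show ?thesis using q 2 by blast
    next
      case (3 m \<rho> N)
      obtain q where q: "q \<in> coboundaries" "dist q p < e" "fst q ^ (Suc m * n0) = rot \<rho>"
        using n0[of "Suc m * n0" "rot \<rho>" 1] rot_unit by auto
      then have "dist (fst q ^ (Suc m * n0)) (rot \<rho>) < 1 / real (Suc N)" by (simp del: mult_Suc power_mult)
      then have "q \<in> A3 m \<rho> N" unfolding A3_def by blast
      then show ?thesis using q 3 by blast
    next
      case (4 N c)
      from 4(2) have "cmod c = 1" by auto
      from dense_power_average[OF p e C h2 this, of N] show ?thesis
        unfolding 4(1) A4_def good_def by blast
    qed
  qed
  obtain p where p: "p \<in> closure coboundaries" "\<And>U. U \<in> \<U> \<Longrightarrow> p \<in> U"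
    using Baire_closure[OF count ne op dense] by blast
  have inA1: "p \<in> A1 N" for N
    by (rule p(2)[unfolded \<U>_def], rule UnI1, rule UnI1, rule UnI1, rule rangeI)
  have inA2: "p \<in> A2 m \<rho> N" for m \<rho> N
    by (rule p(2)[unfolded \<U>_def], rule UnI1, rule UnI1, rule UnI2, rule UN_I[OF UNIV_I], rule UN_I[OF UNIV_I], rule rangeI)
  have inA3: "p \<in> A3 m \<rho> N" for m \<rho> N
    by (rule p(2)[unfolded \<U>_def], rule UnI1, rule UnI2, rule UN_I[OF UNIV_I], rule UN_I[OF UNIV_I], rule rangeI)
  have inA4: "p \<in> A4 N c" if "c \<in> {1, -1}" for N c
    by (rule p(2)[unfolded \<U>_def], rule UnI2, rule UN_I[OF that], rule rangeI)
  have near_rot: "\<exists>\<rho>. dist (rot \<rho>) \<beta> < e" if b: "cmod \<beta> = 1" and e: "e > 0" for \<beta> e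
  proof -
    obtain y where y: "\<beta> = cis y" using b cis_Arg by (metis div_by_1 norm_zero of_real_1 sgn_eq zero_neq_one)
    obtain \<rho> :: rat where "y < of_rat \<rho>" "of_rat \<rho> < y + e" using of_rat_dense[of y "y + e"] e by auto
    then have "\<bar>of_rat \<rho> - y\<bar> < e" by simp
    then have "dist (rot \<rho>) \<beta> < e"
      using cmod_cis_diff_le[of "of_rat \<rho>" y] unfolding rot_def y dist_norm by linarith
    then show ?thesis by blast
  qed
  show ?thesis
  proof (rule that[of p])
    show "cmod (fst p) = 1" "cmod (apply_bcontfun (snd p) z) = 1" for z
      using closure_coboundaries[OF p(1)] by auto
    show "\<exists>q. prime q \<and> (\<forall>x\<in>torus. dist ((skew p ^^ q) x) x < h1 q / real (Suc N))" for N
      using inA1[of N] unfolding A1_def close_to_on_torus_def by blast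
    show "\<exists>n. \<forall>x\<in>torus. dist ((skew p ^^ (m * n)) x) (fst x, \<beta> * snd x) < e"
      if m: "m > 0" and b: "cmod \<beta> = 1" and e: "e > 0" for m \<beta> e
    proof -
      obtain \<rho> where \<rho>: "dist (rot \<rho>) \<beta> < e / 2" using near_rot[OF b, of "e / 2"] e by auto
      obtain N where N: "1 / real (Suc N) < e / 2" using e nat_approx_posE[of "e / 2"] by auto
      obtain n where n: "\<And>x. x \<in> torus \<Longrightarrow> dist ((skew p ^^ (m * n)) x) (R \<rho> x) < 1 / real (Suc N)"
        using inA2[of "m - 1" \<rho> N] m unfolding A2_def close_to_on_torus_def by auto
      have "dist ((skew p ^^ (m * n)) x) (fst x, \<beta> * snd x) < e" if x: "x \<in> torus" for x
      proof -
        have "dist (R \<rho> x) (fst x, \<beta> * snd x) = dist (rot \<rho>) \<beta> * cmod (snd x)"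
          unfolding R_def by (simp add: dist_prod_def dist_norm left_diff_distrib[symmetric] norm_mult)
        also have "cmod (snd x) = 1" using x by auto
        finally have "dist (R \<rho> x) (fst x, \<beta> * snd x) < e / 2" using \<rho> by simp
        then show ?thesis
          using dist_triangle[of "(skew p ^^ (m * n)) x" "(fst x, \<beta> * snd x)" "R \<rho> x"] n[OF x] N by linarith
      qed
      then show ?thesis by blast
    qed
    show "\<exists>n. dist (fst p ^ (m * n)) \<alpha> < e" if m: "m > 0" and b: "cmod \<alpha> = 1" and e: "e > 0" for m \<alpha> e
    proof -
      obtain \<rho> where \<rho>: "dist (rot \<rho>) \<alpha> < e / 2" using near_rot[OF b, of "e / 2"] e by auto
      obtain N where N: "1 / real (Suc N) < e / 2" using e nat_approx_posE[of "e / 2"] by auto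
      have Sm: "Suc (m - 1) = m" using m by simp
      obtain n where n: "dist (fst p ^ (m * n)) (rot \<rho>) < 1 / real (Suc N)"
        using inA3[of "m - 1" \<rho> N] unfolding A3_def Sm by blast
      then have "dist (fst p ^ (m * n)) \<alpha> < e"
        using dist_triangle[of "fst p ^ (m * n)" \<alpha> "rot \<rho>"] \<rho> N by linarith
      then show ?thesis by blast
    qed
    show "\<exists>r>N. squarefree r \<and> (\<forall>p. prime p \<and> p dvd r \<longrightarrow> p > N) \<and>
      real (num_prime_divisors r) < h2 r \<and> cmod (power_average C r p - c) < 1 / 2" if "c \<in> {1, -1}" for N c
      using inA4[OF that, of N] unfolding A4_def good_def by blast
  qed
qed

section \<open>Transport to real sequences\<close>

text \<open>Four real coordinates padded with zeros, which realise the torus in the carrier type of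
  the theorem.\<close>

definition seq_of :: "complex \<times> complex \<Rightarrow> nat \<Rightarrow> real" where
  "seq_of x = (\<lambda>n. 0)(0 := Re (fst x), 1 := Im (fst x), 2 := Re (snd x), 3 := Im (snd x))"

definition of_seq :: "(nat \<Rightarrow> real) \<Rightarrow> complex \<times> complex" where
  "of_seq s = (Complex (s 0) (s 1), Complex (s 2) (s 3))"

lemma of_seq_seq_of [simp]: "of_seq (seq_of x) = x"
  by (simp add: of_seq_def seq_of_def complex_surj)

abbreviation seq_torus :: "(nat \<Rightarrow> real) set" where
  "seq_torus \<equiv> seq_of ` torus"

text \<open>The distance pulled back along \<open>of_seq\<close>, which makes \<open>seq_of\<close>
  an isometry. It separates points on \<open>seq_torus\<close>, but not among all sequences, because
  \<open>of_seq\<close> forgets all later entries.\<close>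

definition seq_dist :: "(nat \<Rightarrow> real) \<Rightarrow> (nat \<Rightarrow> real) \<Rightarrow> real" where
  "seq_dist s t = dist (of_seq s) (of_seq t)"

definition seq_skew :: "complex \<times> (complex \<Rightarrow>\<^sub>C complex) \<Rightarrow> (nat \<Rightarrow> real) \<Rightarrow> nat \<Rightarrow> real" where
  "seq_skew p s = seq_of (skew p (of_seq s))"

lemma Metric_space_seq_torus: "Metric_space seq_torus seq_dist"
proof
  show "seq_dist x z \<le> seq_dist x y + seq_dist y z" for x y z
    unfolding seq_dist_def by (rule dist_triangle)
qed (auto simp: seq_dist_def dist_commute)

interpretation ST: Metric_space seq_torus seq_dist
  by (rule Metric_space_seq_torus)

lemma openin_seq_torus: "openin ST.mtopology U \<longleftrightarrow> (\<exists>T. open T \<and> U = of_seq -` T \<inter> seq_torus)"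
proof
  assume U: "openin ST.mtopology U"
  then have "\<forall>x\<in>U. \<exists>r>0. ST.mball x r \<subseteq> U" unfolding ST.openin_mtopology by blast
  then obtain r where r: "\<And>x. x \<in> U \<Longrightarrow> r x > 0" "\<And>x. x \<in> U \<Longrightarrow> ST.mball x (r x) \<subseteq> U"
    by (auto dest!: bchoice)
  let ?T = "\<Union>x\<in>U. ball (of_seq x) (r x)"
  have sub: "U \<subseteq> seq_torus" using U unfolding ST.openin_mtopology by blast
  have "U \<subseteq> of_seq -` ?T \<inter> seq_torus" using sub r(1) by force
  moreover have "of_seq -` ?T \<inter> seq_torus \<subseteq> U"
  proof
    fix y assume "y \<in> of_seq -` ?T \<inter> seq_torus"
    then obtain x where x: "x \<in> U" "dist (of_seq x) (of_seq y) < r x" "y \<in> seq_torus" by auto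
    then have "y \<in> ST.mball x (r x)" using sub by (auto simp: ST.in_mball seq_dist_def)
    then show "y \<in> U" using r(2)[OF x(1)] by blast
  qed
  ultimately show "\<exists>T. open T \<and> U = of_seq -` T \<inter> seq_torus"
    by (intro exI[of _ ?T] conjI open_UN ballI open_ball) (rule subset_antisym)
next
  assume "\<exists>T. open T \<and> U = of_seq -` T \<inter> seq_torus"
  then obtain T where T: "open T" "U = of_seq -` T \<inter> seq_torus" by blast
  show "openin ST.mtopology U"
    unfolding ST.openin_mtopology
  proof (intro conjI allI impI)
    show "U \<subseteq> seq_torus" using T by blast
    fix x assume x: "x \<in> U"
    then obtain r where r: "r > 0" "ball (of_seq x) r \<subseteq> T" using T openE by blast
    have "ST.mball x r \<subseteq> U"
    proof
      fix y assume y: "y \<in> ST.mball x r"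
      then have "of_seq y \<in> ball (of_seq x) r" by (simp add: ST.in_mball seq_dist_def)
      moreover have "y \<in> seq_torus" using y by (simp add: ST.in_mball)
      ultimately show "y \<in> U" using r(2) T(2) by blast
    qed
    then show "\<exists>r>0. ST.mball x r \<subseteq> U" using r(1) by blast
  qed
qed

lemma topspace_seq_torus: "topspace ST.mtopology = seq_torus"
  by simp

lemma continuous_map_of_seq:
  assumes "continuous_on UNIV f"
  shows "continuous_map ST.mtopology euclidean (\<lambda>s. f (of_seq s))"
  unfolding continuous_map_def topspace_seq_torus
proof (intro conjI allI impI)
  fix U :: "'a set" assume U: "openin euclidean U"
  have "{x \<in> seq_torus. f (of_seq x) \<in> U} = of_seq -` (f -` U) \<inter> seq_torus" by auto
  moreover have "open (f -` U)" using assms U by (simp add: open_vimage)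
  ultimately show "openin ST.mtopology {x \<in> seq_torus. f (of_seq x) \<in> U}"
    unfolding openin_seq_torus by blast
qed simp

lemma compact_space_seq_torus: "compact_space ST.mtopology"
proof -
  have "continuous_map (top_of_set torus) ST.mtopology seq_of"
    unfolding continuous_map_def topspace_seq_torus
  proof (intro conjI allI impI)
    show "seq_of \<in> topspace (top_of_set torus) \<rightarrow> seq_torus" by simp
    fix U assume "openin ST.mtopology U"
    then obtain T where T: "open T" "U = of_seq -` T \<inter> seq_torus" unfolding openin_seq_torus by blast
    then have "{x \<in> topspace (top_of_set torus). seq_of x \<in> U} = torus \<inter> T" by auto
    then show "openin (top_of_set torus) {x \<in> topspace (top_of_set torus). seq_of x \<in> U}"
      using T(1) by (simp add: openin_open_Int)
  qed
  moreover have "compactin (top_of_set torus) torus"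
    using compact_torus by (simp add: compactin_subtopology)
  ultimately have "compactin ST.mtopology (seq_of ` torus)" by (rule image_compactin[rotated])
  then show ?thesis unfolding compact_space_def topspace_seq_torus .
qed

lemma seq_skew_power:
  assumes "x \<in> seq_torus"
  shows "(seq_skew p ^^ n) x = seq_of ((skew p ^^ n) (of_seq x))"
  using assms by (induction n) (auto simp: seq_skew_def)

text \<open>A continuous bijection of a compact Hausdorff space has a continuous inverse;
  bijectivity is division by the unimodular multipliers. Powers follow by composition.\<close>

lemma homeomorphic_map_seq_skew_power:
  assumes a: "cmod (fst p) = 1" and g: "\<And>z. cmod (apply_bcontfun (snd p) z) = 1"
  shows "homeomorphic_map ST.mtopology ST.mtopology (seq_skew p ^^ n)"
proof (induction n)
  case 0
  then show ?case by (simp add: homeomorphic_map_id[unfolded id_def])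
next
  case (Suc n)
  have nz: "fst p \<noteq> 0" "apply_bcontfun (snd p) z \<noteq> 0" for z using a g[of z] by auto
  have T: "seq_skew p ` seq_torus = seq_torus"
  proof
    show "seq_skew p ` seq_torus \<subseteq> seq_torus"
      using skew_power_in_torus[OF a g, of _ 1] by (auto simp: seq_skew_def simp del: mem_Times_iff)
    show "seq_torus \<subseteq> seq_skew p ` seq_torus"
    proof clarify
      fix z w :: complex assume zw: "z \<in> sphere 0 1" "w \<in> sphere 0 1"
      let ?y = "(z / fst p, w / apply_bcontfun (snd p) (z / fst p))"
      have "?y \<in> torus" using zw a g by (simp add: norm_divide)
      moreover have "skew p ?y = (z, w)" using nz by (simp add: skew_def)
      ultimately have "seq_of (z, w) = seq_skew p (seq_of ?y)" "seq_of ?y \<in> seq_torus"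
        by (auto simp: seq_skew_def)
      then show "seq_of (z, w) \<in> seq_skew p ` seq_torus" by blast
    qed
  qed
  have "homeomorphic_map ST.mtopology ST.mtopology (seq_skew p)"
  proof (rule continuous_imp_homeomorphic_map)
    show "continuous_map ST.mtopology ST.mtopology (seq_skew p)"
      unfolding continuous_map_def topspace_seq_torus
    proof (intro conjI allI impI)
      show "seq_skew p \<in> seq_torus \<rightarrow> seq_torus" using T by blast
      fix U assume "openin ST.mtopology U"
      then obtain V where V: "open V" "U = of_seq -` V \<inter> seq_torus" unfolding openin_seq_torus by blast
      have "{x \<in> seq_torus. seq_skew p x \<in> U} = of_seq -` (skew p -` V) \<inter> seq_torus"
        using T unfolding V(2) by (auto simp: seq_skew_def)
      moreover have "open (skew p -` V)"
        using V(1) continuous_on_skew_power[of UNIV 1 p] by (simp add: open_vimage)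
      ultimately show "openin ST.mtopology {x \<in> seq_torus. seq_skew p x \<in> U}"
        unfolding openin_seq_torus by blast
    qed
    show "inj_on (seq_skew p) (topspace ST.mtopology)"
    proof (rule inj_onI)
      fix x y assume xy: "x \<in> topspace ST.mtopology" "y \<in> topspace ST.mtopology" "seq_skew p x = seq_skew p y"
      then obtain u v where uv: "x = seq_of u" "y = seq_of v" by auto
      have "skew p u = skew p v" using arg_cong[OF xy(3), of of_seq] unfolding uv by (simp add: seq_skew_def)
      then have "fst u = fst v" "snd u = snd v" using nz by (auto simp: skew_def)
      then have "u = v" by (rule prod_eqI)
      then show "x = y" unfolding uv by simp
    qed
  qed (simp_all add: compact_space_seq_torus ST.Hausdorff_space_mtopology T)
  from homeomorphic_map_compose[OF Suc this] show ?case by (simp add: o_def)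
qed

section \<open>Unique ergodicity of the transported system\<close>

lemma space_metric_borel_seq_torus: "space (metric_borel seq_torus seq_dist) = seq_torus"
  unfolding metric_borel_def by (rule space_measure_of) (use ST.openin_mtopology in blast)

lemma sets_metric_borel_seq_torus:
  "sets (metric_borel seq_torus seq_dist) = {of_seq -` B \<inter> seq_torus | B. B \<in> sets borel}"
proof -
  have "sets (metric_borel seq_torus seq_dist) = sigma_sets seq_torus {U. openin ST.mtopology U}"
    unfolding metric_borel_def by (rule sets_measure_of) (use ST.openin_mtopology in blast)
  also have "{U. openin ST.mtopology U} = {of_seq -` T \<inter> seq_torus | T. T \<in> {T. open T}}"
    unfolding openin_seq_torus by auto
  also have "sigma_sets seq_torus \<dots> = {of_seq -` B \<inter> seq_torus | B. B \<in> sigma_sets UNIV {T. open T}}"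
    by (rule sigma_sets_vimage_commute[symmetric]) simp
  finally show ?thesis unfolding borel_def by simp
qed

lemma emeasure_torus_measure_skew_power:
  assumes a: "cmod (fst p) = 1" and g: "\<And>z. cmod (apply_bcontfun (snd p) z) = 1" and B: "B \<in> sets borel"
  shows "emeasure torus_measure ((skew p ^^ n) -` B) = emeasure torus_measure B"
  using B
proof (induction n arbitrary: B)
  case (Suc n)
  have meas: "skew p \<in> measurable torus_measure borel"
  proof -
    have "continuous_on UNIV (skew p)" using continuous_on_skew_power[of UNIV 1 p] by simp
    then show ?thesis
      using borel_measurable_continuous_onI measurable_cong_sets[OF sets_torus_measure refl] by blast
  qed
  have sp: "space torus_measure = UNIV" using sets_eq_imp_space_eq[OF sets_torus_measure] by simp
  have "emeasure torus_measure (skew p -` B) = emeasure (distr torus_measure borel (skew p)) B"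
    using emeasure_distr[OF meas Suc.prems] sp by simp
  also have "\<dots> = emeasure torus_measure B" by (simp only: distr_torus_measure_skew[OF a g])
  finally have 1: "emeasure torus_measure (skew p -` B) = emeasure torus_measure B" .
  have "skew p -` B \<in> sets borel"
    using measurable_sets[OF meas Suc.prems] sp sets_torus_measure by simp
  from Suc.IH[OF this] have "emeasure torus_measure ((skew p ^^ n) -` (skew p -` B)) = emeasure torus_measure B"
    unfolding 1 .
  then show ?case by (simp add: vimage_comp o_def)
qed simp

text \<open>Existence comes from transporting \<open>torus_measure\<close> to sequences. For
  uniqueness, an invariant measure is pushed back along \<open>of_seq\<close>, where the hypothesis
  identifies it.\<close>

lemma uniquely_ergodic_seq_skew_power:
  assumes a: "cmod (fst p) = 1" and g: "\<And>z. cmod (apply_bcontfun (snd p) z) = 1"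
    and unique: "\<And>M. prob_space M \<Longrightarrow> sets M = sets borel \<Longrightarrow> AE x in M. x \<in> torus \<Longrightarrow>
      distr M borel (skew p ^^ m) = M \<Longrightarrow> M = torus_measure"
  shows "uniquely_ergodic seq_torus seq_dist (seq_skew p ^^ m)"
  unfolding uniquely_ergodic_def
proof (intro conjI ex_ex1I)
  show "topological_dynamical_system seq_torus seq_dist (seq_skew p ^^ m)"
    unfolding topological_dynamical_system_def
    using Metric_space_seq_torus compact_space_seq_torus homeomorphic_map_seq_skew_power[OF a g] by blast
next
  let ?B = "metric_borel seq_torus seq_dist"
  \<comment> \<open>\<open>torus_measure\<close> lives on all pairs of complex numbers; points off
    the torus, a null set, get the default image \<open>seq_of (1, 1)\<close> so that all values lie
    in \<open>seq_torus\<close>.\<close>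
  define \<iota> where "\<iota> x = (if x \<in> torus then seq_of x else seq_of (1, 1))" for x
  have torus_borel: "torus \<in> sets borel" by (rule borel_closed[OF compact_imp_closed[OF compact_torus]])
  have space_tm: "space torus_measure = UNIV" using sets_eq_imp_space_eq[OF sets_torus_measure] by simp
  have vim: "\<iota> -` (of_seq -` A \<inter> seq_torus) = (torus \<inter> A) \<union> (if (1, 1) \<in> A then - torus else {})" for A
  proof (rule Set.set_eqI)
    fix x
    have "\<iota> x \<in> seq_torus" unfolding \<iota>_def by auto
    moreover have "of_seq (\<iota> x) = (if x \<in> torus then x else (1, 1))" unfolding \<iota>_def by simp
    ultimately have "x \<in> \<iota> -` (of_seq -` A \<inter> seq_torus) \<longleftrightarrow> (if x \<in> torus then x else (1, 1)) \<in> A"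
      by (simp only: vimage_eq Int_iff simp_thms)
    then show "x \<in> \<iota> -` (of_seq -` A \<inter> seq_torus) \<longleftrightarrow> x \<in> (torus \<inter> A) \<union> (if (1, 1) \<in> A then - torus else {})"
      by (cases "x \<in> torus"; cases "(1, 1) \<in> A") (simp_all only: Un_iff Int_iff Compl_iff if_True if_False empty_iff simp_thms)
  qed
  have meas: "\<iota> \<in> measurable torus_measure ?B"
  proof (rule measurableI)
    show "\<iota> x \<in> space ?B" for x unfolding space_metric_borel_seq_torus \<iota>_def by auto
    fix A assume "A \<in> sets ?B"
    then obtain E where E: "E \<in> sets borel" "A = of_seq -` E \<inter> seq_torus"
      unfolding sets_metric_borel_seq_torus by blast
    have "\<iota> -` A \<in> sets borel" unfolding E(2) vim using E(1) torus_borel by auto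
    then show "\<iota> -` A \<inter> space torus_measure \<in> sets torus_measure"
      by (simp add: space_tm sets_torus_measure)
  qed
  define \<mu> where "\<mu> = distr torus_measure ?B \<iota>"
  have mu: "emeasure \<mu> (of_seq -` E \<inter> seq_torus) = emeasure torus_measure E" if E: "E \<in> sets borel" for E
  proof -
    have "of_seq -` E \<inter> seq_torus \<in> sets ?B" unfolding sets_metric_borel_seq_torus using E by blast
    then have "emeasure \<mu> (of_seq -` E \<inter> seq_torus) = emeasure torus_measure (\<iota> -` (of_seq -` E \<inter> seq_torus))"
      unfolding \<mu>_def by (simp add: emeasure_distr[OF meas] space_tm)
    also have "\<dots> = emeasure torus_measure E"
    proof (rule emeasure_eq_AE)
      show "AE x in torus_measure. x \<in> \<iota> -` (of_seq -` E \<inter> seq_torus) \<longleftrightarrow> x \<in> E"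
        unfolding vim using AE_torus_measure by eventually_elim auto
      show "\<iota> -` (of_seq -` E \<inter> seq_torus) \<in> sets torus_measure" "E \<in> sets torus_measure"
        unfolding vim sets_torus_measure using E torus_borel by auto
    qed
    finally show ?thesis .
  qed
  have vim_skew: "(seq_skew p ^^ m) -` (of_seq -` E \<inter> seq_torus) \<inter> seq_torus
      = of_seq -` ((skew p ^^ m) -` E) \<inter> seq_torus" for E
  proof (intro Set.set_eqI iffI)
    fix x assume "x \<in> (seq_skew p ^^ m) -` (of_seq -` E \<inter> seq_torus) \<inter> seq_torus"
    then have x: "x \<in> seq_torus" "of_seq ((seq_skew p ^^ m) x) \<in> E" by blast+
    from x(2) have "(skew p ^^ m) (of_seq x) \<in> E" unfolding seq_skew_power[OF x(1)] of_seq_seq_of .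
    then show "x \<in> of_seq -` ((skew p ^^ m) -` E) \<inter> seq_torus" using x(1) by blast
  next
    fix x assume "x \<in> of_seq -` ((skew p ^^ m) -` E) \<inter> seq_torus"
    then have x: "x \<in> seq_torus" "(skew p ^^ m) (of_seq x) \<in> E" by blast+
    from x(1) have "of_seq x \<in> torus" by auto
    then have "(skew p ^^ m) (of_seq x) \<in> torus" by (rule skew_power_in_torus[OF a g])
    then have "(seq_skew p ^^ m) x \<in> seq_torus"
      unfolding seq_skew_power[OF x(1)] by (rule imageI)
    moreover have "of_seq ((seq_skew p ^^ m) x) \<in> E"
      unfolding seq_skew_power[OF x(1)] of_seq_seq_of by (rule x(2))
    ultimately show "x \<in> (seq_skew p ^^ m) -` (of_seq -` E \<inter> seq_torus) \<inter> seq_torus"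
      using x(1) by (simp only: Int_iff vimage_eq simp_thms)
  qed
  have skew_borel: "(skew p ^^ m) -` E \<in> sets borel" if "E \<in> sets borel" for E
    using measurable_sets[OF borel_measurable_continuous_onI[OF continuous_on_skew_power] that] by simp
  have "invariant_prob_measure seq_torus seq_dist (seq_skew p ^^ m) \<mu>"
    unfolding invariant_prob_measure_def
  proof (intro conjI ballI)
    show "prob_space \<mu>" unfolding \<mu>_def by (rule prob_space.prob_space_distr[OF prob_space_torus_measure meas])
    show "sets \<mu> = sets ?B" by (simp add: \<mu>_def)
    fix A assume "A \<in> sets \<mu>"
    then obtain E where E: "E \<in> sets borel" "A = of_seq -` E \<inter> seq_torus"
      unfolding \<mu>_def sets_distr sets_metric_borel_seq_torus by blast
    show "emeasure \<mu> ((seq_skew p ^^ m) -` A \<inter> seq_torus) = emeasure \<mu> A"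
      unfolding E(2) vim_skew mu[OF E(1)] mu[OF skew_borel[OF E(1)]]
      by (rule emeasure_torus_measure_skew_power[OF a g E(1)])
  qed
  then show "\<exists>\<mu>. invariant_prob_measure seq_torus seq_dist (seq_skew p ^^ m) \<mu>" by blast
  have det: "emeasure \<nu> (of_seq -` E \<inter> seq_torus) = emeasure torus_measure E"
    if \<nu>: "invariant_prob_measure seq_torus seq_dist (seq_skew p ^^ m) \<nu>" and E: "E \<in> sets borel" for \<nu> E
  proof -
    have ps: "prob_space \<nu>" and sets: "sets \<nu> = sets ?B"
      and inv: "\<And>A. A \<in> sets \<nu> \<Longrightarrow> emeasure \<nu> ((seq_skew p ^^ m) -` A \<inter> seq_torus) = emeasure \<nu> A"
      using \<nu> unfolding invariant_prob_measure_def by auto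
    have space: "space \<nu> = seq_torus"
      using sets_eq_imp_space_eq[OF sets] space_metric_borel_seq_torus by simp
    have in_sets: "of_seq -` A \<inter> seq_torus \<in> sets \<nu>" if "A \<in> sets borel" for A
      unfolding sets sets_metric_borel_seq_torus using that by blast
    have mo: "of_seq \<in> measurable \<nu> borel"
      by (rule measurableI) (use in_sets space in auto)
    let ?M = "distr \<nu> borel of_seq"
    have M: "emeasure ?M A = emeasure \<nu> (of_seq -` A \<inter> seq_torus)" if "A \<in> sets borel" for A
      using emeasure_distr[OF mo that] space by simp
    have "?M = torus_measure"
    proof (rule unique)
      show "prob_space ?M" by (rule prob_space.prob_space_distr[OF ps mo])
      have "{x \<in> space borel. x \<in> torus} \<in> sets borel" using torus_borel by simp
      moreover have "AE x in \<nu>. of_seq x \<in> torus"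
        by (rule AE_I2) (use space in auto)
      ultimately show "AE x in ?M. x \<in> torus" by (simp only: AE_distr_iff[OF mo])
      have ms: "(skew p ^^ m) \<in> measurable ?M borel"
        using borel_measurable_continuous_onI[OF continuous_on_skew_power] by simp
      show "distr ?M borel (skew p ^^ m) = ?M"
      proof (rule measure_eqI)
        fix A assume "A \<in> sets (distr ?M borel (skew p ^^ m))"
        then have A: "A \<in> sets borel" by simp
        have "emeasure (distr ?M borel (skew p ^^ m)) A = emeasure ?M ((skew p ^^ m) -` A)"
          using emeasure_distr[OF ms A] by simp
        also have "\<dots> = emeasure ?M A"
          unfolding M[OF A] M[OF skew_borel[OF A]] vim_skew[symmetric] by (rule inv[OF in_sets[OF A]])
        finally show "emeasure (distr ?M borel (skew p ^^ m)) A = emeasure ?M A" .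
      qed simp
    qed simp
    then show ?thesis using M[OF E] by simp
  qed
  show "\<mu>1 = \<mu>2" if \<mu>12: "invariant_prob_measure seq_torus seq_dist (seq_skew p ^^ m) \<mu>1"
    "invariant_prob_measure seq_torus seq_dist (seq_skew p ^^ m) \<mu>2" for \<mu>1 \<mu>2
  proof (rule measure_eqI)
    show "sets \<mu>1 = sets \<mu>2" using \<mu>12 unfolding invariant_prob_measure_def by simp
    fix A assume "A \<in> sets \<mu>1"
    moreover have "sets \<mu>1 = sets ?B" using \<mu>12(1) unfolding invariant_prob_measure_def by simp
    ultimately obtain E where "E \<in> sets borel" "A = of_seq -` E \<inter> seq_torus"
      unfolding sets_metric_borel_seq_torus by blast
    then show "emeasure \<mu>1 A = emeasure \<mu>2 A" using det[OF \<mu>12(1)] det[OF \<mu>12(2)] by simp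
  qed
qed

text \<open>Consecutive terms are near opposite signs, so they differ by more than 2 - 1 / 2 - 1 / 2
  = 1.\<close>

lemma not_convergent_alternating:
  fixes s :: "nat \<Rightarrow> complex"
  assumes "\<And>n. cmod (s n - (-1) ^ n) < 1 / 2"
  shows "\<not> convergent s"
proof
  assume "convergent s"
  then obtain L where L: "s \<longlonglongrightarrow> L" by (auto simp: convergent_def)
  have "(\<lambda>n. s (Suc n) - s n) \<longlonglongrightarrow> L - L"
    by (intro tendsto_diff L LIMSEQ_Suc)
  then have "eventually (\<lambda>n. dist (s (Suc n) - s n) 0 < 1) sequentially"
    by (intro tendstoD) simp_all
  then obtain n where n: "cmod (s (Suc n) - s n) < 1"
    by (auto simp: eventually_sequentially)
  have "2 = cmod ((-1) ^ Suc n - (-1) ^ n)" by (cases "even n") auto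
  also have "(-1) ^ Suc n - (-1) ^ n = (s (Suc n) - s n) - (s (Suc n) - (-1) ^ Suc n) + (s n - (-1) ^ n)"
    by simp
  also have "cmod \<dots> \<le> cmod (s (Suc n) - s n) + cmod (s (Suc n) - (-1) ^ Suc n) + cmod (s n - (-1) ^ n)"
    by (intro norm_triangle_mono norm_triangle_ineq4 order_refl)
  finally show False using n assms[of n] assms[of "Suc n"] by linarith
qed

(* Every compact metric space embeds in the countable product of copies of the reals, so
   restricting the carrier to a set of real sequences, with an arbitrary metric d on it, loses
   no generality.  Divergence of r to infinity rules out sequences taking the value 1
   infinitely often, which coprimality alone does not exclude. *)
theorem theorem11:
  fixes C :: nat and h1 h2 :: "nat \<Rightarrow> real"
  assumes "C \<ge> 2"
    and "\<And>n. n > 0 \<Longrightarrow> h1 n > 0"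
    and "\<And>n. n > 0 \<Longrightarrow> h2 n > 0"
    and "filterlim h2 at_top sequentially"
  shows "\<exists>(X :: (nat \<Rightarrow> real) set) (d :: (nat \<Rightarrow> real) \<Rightarrow> (nat \<Rightarrow> real) \<Rightarrow> real)
            (T :: (nat \<Rightarrow> real) \<Rightarrow> (nat \<Rightarrow> real)) (q :: nat \<Rightarrow> nat) (r :: nat \<Rightarrow> nat).
     totally_uniquely_ergodic X d T \<and>
     (\<forall>n. prime (q n)) \<and>
     (\<lambda>n. SUP x\<in>X. d x ((T ^^ q n) x)) \<in> o(\<lambda>n. h1 (q n)) \<and>
     (\<forall>n. r n > 0 \<and> squarefree (r n)) \<and>
     (\<forall>m n. m \<noteq> n \<longrightarrow> coprime (r m) (r n)) \<and>
     filterlim r at_top sequentially \<and>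
     (\<forall>n. real (num_prime_divisors (r n)) < h2 (r n)) \<and>
     (\<exists>(f :: (nat \<Rightarrow> real) \<Rightarrow> complex) x.
        continuous_map (Metric_space.mtopology X d) euclidean f \<and> x \<in> X \<and>
        \<not> convergent (\<lambda>n. (1 / of_nat (r n)) *
            (\<Sum>i<r n. of_nat (power_count C (r n) (int i)) * f ((T ^^ i) x))))"
proof (rule ex_generic_skew[OF assms(1,2,4)])
  fix p :: "complex \<times> (complex \<Rightarrow>\<^sub>C complex)"
  assume a: "cmod (fst p) = 1" and g: "\<And>z. cmod (apply_bcontfun (snd p) z) = 1"
    and rigid: "\<And>N. \<exists>q. prime q \<and> (\<forall>x\<in>torus. dist ((skew p ^^ q) x) x < h1 q / real (Suc N))"
    and vert: "\<And>m \<beta> e. m > 0 \<Longrightarrow> cmod \<beta> = 1 \<Longrightarrow> e > 0 \<Longrightarrow>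
      \<exists>n. \<forall>x\<in>torus. dist ((skew p ^^ (m * n)) x) (fst x, \<beta> * snd x) < e"
    and hor: "\<And>m \<alpha> e. m > 0 \<Longrightarrow> cmod \<alpha> = 1 \<Longrightarrow> e > 0 \<Longrightarrow> \<exists>n. dist (fst p ^ (m * n)) \<alpha> < e"
    and avg: "\<And>N c. c \<in> {1, -1} \<Longrightarrow> \<exists>r>N. squarefree r \<and> (\<forall>p. prime p \<and> p dvd r \<longrightarrow> p > N) \<and>
      real (num_prime_divisors r) < h2 r \<and> cmod (power_average C r p - c) < 1 / 2"
  have tds: "topological_dynamical_system seq_torus seq_dist (seq_skew p)"
    unfolding topological_dynamical_system_def
    using Metric_space_seq_torus compact_space_seq_torus homeomorphic_map_seq_skew_power[OF a g, of 1] by simp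
  have "uniquely_ergodic seq_torus seq_dist (seq_skew p ^^ m)" if "m > 0" for m
    by (rule uniquely_ergodic_seq_skew_power[OF a g])
      (rule invariant_measure_eq_torus_measure[OF a g vert[OF that] hor[OF that]])
  then have tue: "totally_uniquely_ergodic seq_torus seq_dist (seq_skew p)"
    unfolding totally_uniquely_ergodic_def using tds by blast
  obtain q where q: "\<And>N. prime (q N)"
    "\<And>N x. x \<in> torus \<Longrightarrow> dist ((skew p ^^ q N) x) x < h1 (q N) / real (Suc N)"
    using rigid by metis
  have ne: "seq_torus \<noteq> {}" by auto
  have sup: "0 \<le> (SUP x\<in>seq_torus. seq_dist x ((seq_skew p ^^ q N) x))"
    "(SUP x\<in>seq_torus. seq_dist x ((seq_skew p ^^ q N) x)) \<le> h1 (q N) / real (Suc N)" for N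
  proof -
    have le: "seq_dist x ((seq_skew p ^^ q N) x) \<le> h1 (q N) / real (Suc N)" if x: "x \<in> seq_torus" for x
    proof -
      have "of_seq x \<in> torus" using x by auto
      then have "dist (of_seq x) ((skew p ^^ q N) (of_seq x)) < h1 (q N) / real (Suc N)"
        using q(2)[of "of_seq x" N] by (simp add: dist_commute)
      then show ?thesis unfolding seq_dist_def seq_skew_power[OF x] of_seq_seq_of by (rule less_imp_le)
    qed
    then show "(SUP x\<in>seq_torus. seq_dist x ((seq_skew p ^^ q N) x)) \<le> h1 (q N) / real (Suc N)"
      by (rule cSUP_least[OF ne])
    have x0: "seq_of (1, 1) \<in> seq_torus" by simp
    \<comment> \<open>A real supremum dominates its members only if they are bounded above; this is
      what makes it nonnegative here.\<close>
    have "bdd_above ((\<lambda>x. seq_dist x ((seq_skew p ^^ q N) x)) ` seq_torus)"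
      by (rule bdd_aboveI2[OF le])
    then have "seq_dist (seq_of (1, 1)) ((seq_skew p ^^ q N) (seq_of (1, 1))) \<le> (SUP x\<in>seq_torus. seq_dist x ((seq_skew p ^^ q N) x))"
      by (rule cSUP_upper[OF x0])
    moreover have "0 \<le> seq_dist (seq_of (1, 1)) ((seq_skew p ^^ q N) (seq_of (1, 1)))"
      unfolding seq_dist_def by (rule zero_le_dist)
    ultimately show "0 \<le> (SUP x\<in>seq_torus. seq_dist x ((seq_skew p ^^ q N) x))" by linarith
  qed
  have h1q: "h1 (q N) > 0" for N using assms(2)[of "q N"] q(1)[of N] by (simp add: prime_gt_0_nat)
  have small: "(\<lambda>N. SUP x\<in>seq_torus. seq_dist x ((seq_skew p ^^ q N) x)) \<in> o(\<lambda>N. h1 (q N))"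
  proof (rule smalloI_tendsto)
    show "(\<lambda>N. (SUP x\<in>seq_torus. seq_dist x ((seq_skew p ^^ q N) x)) / h1 (q N)) \<longlonglongrightarrow> 0"
    proof (rule Lim_null_comparison[OF always_eventually LIMSEQ_inverse_real_of_nat], rule allI)
      fix N
      have "(SUP x\<in>seq_torus. seq_dist x ((seq_skew p ^^ q N) x)) / h1 (q N) \<le> (h1 (q N) / real (Suc N)) / h1 (q N)"
        using sup(2)[of N] h1q[of N] by (intro divide_right_mono) auto
      also have "\<dots> = inverse (real (Suc N))" using h1q[of N] by (simp add: inverse_eq_divide)
      finally show "norm ((SUP x\<in>seq_torus. seq_dist x ((seq_skew p ^^ q N) x)) / h1 (q N)) \<le> inverse (real (Suc N))"
        using sup(1)[of N] h1q[of N] by simp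
    qed
    show "\<forall>\<^sub>F N in sequentially. h1 (q N) \<noteq> 0"
      by (intro always_eventually allI less_imp_neq[symmetric] h1q)
  qed
  have "\<forall>N n. \<exists>r>N. squarefree r \<and> (\<forall>p. prime p \<and> p dvd r \<longrightarrow> p > N) \<and>
      real (num_prime_divisors r) < h2 r \<and> cmod (power_average C r p - (-1) ^ n) < 1 / 2"
  proof (intro allI)
    fix N n
    have "(-1 :: complex) ^ n \<in> {1, -1}" by (cases "even n") auto
    then show "\<exists>r>N. squarefree r \<and> (\<forall>p. prime p \<and> p dvd r \<longrightarrow> p > N) \<and>
      real (num_prime_divisors r) < h2 r \<and> cmod (power_average C r p - (-1) ^ n) < 1 / 2"
      by (rule avg)
  qed
  then obtain R where R: "\<And>N n. R N n > N" "\<And>N n. squarefree (R N n)"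
    "\<And>N n p. prime p \<Longrightarrow> p dvd R N n \<Longrightarrow> p > N"
    "\<And>N n. real (num_prime_divisors (R N n)) < h2 (R N n)"
    "\<And>N n. cmod (power_average C (R N n) p - (-1) ^ n) < 1 / 2"
    by metis
  \<comment> \<open>All prime factors of each term exceed the previous term, hence every earlier
    one, which gives coprimality; the second argument of \<open>R\<close> alternates the sign of the
    target.\<close>
  define r where "r = rec_nat (R 0 0) (\<lambda>n rn. R rn (Suc n))"
  have r_Suc: "r (Suc n) = R (r n) (Suc n)" for n by (simp add: r_def)
  have r_eq: "\<exists>N. r n = R N n" for n by (cases n) (auto simp: r_def)
  have mono: "strict_mono r" unfolding strict_mono_Suc_iff r_Suc using R(1) by blast
  have pos: "r n > 0" for n using r_eq[of n] R(1) by (metis gr_zeroI not_less_zero)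
  have cop: "coprime (r m) (r n)" if mn: "m < n" for m n
  proof (rule ccontr)
    assume "\<not> coprime (r m) (r n)"
    then have "gcd (r m) (r n) \<noteq> 1" using coprime_iff_gcd_eq_1 by blast
    then obtain s where "prime s" "s dvd gcd (r m) (r n)" using prime_factor_nat by blast
    then have s: "prime s" "s dvd r m" "s dvd r n" by simp_all
    obtain k where k: "n = Suc k" "m \<le> k" using mn by (cases n) auto
    have "r k < s" using R(3)[OF s(1)] s(3) unfolding k(1) r_Suc by blast
    moreover have "r m \<le> r k" using mono k(2) by (simp add: strict_mono_less_eq)
    moreover have "s \<le> r m" using s(2) pos by (intro dvd_imp_le)
    ultimately show False by linarith
  qed
  have div: "\<not> convergent (\<lambda>n. power_average C (r n) p)"
    by (rule not_convergent_alternating) (use r_eq R(5) in metis)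
  have avg_eq: "(1 / of_nat (r n)) * (\<Sum>i<r n. of_nat (power_count C (r n) (int i)) *
      snd (of_seq ((seq_skew p ^^ i) (seq_of (1, 1))))) = power_average C (r n) p" for n
    unfolding power_average_def by (simp add: seq_skew_power)
  have "continuous_map ST.mtopology euclidean (\<lambda>s. snd (of_seq s))"
    by (rule continuous_map_of_seq) (intro continuous_intros)
  moreover have "seq_of (1, 1) \<in> seq_torus" by simp
  ultimately have "\<exists>(f :: (nat \<Rightarrow> real) \<Rightarrow> complex) x. continuous_map ST.mtopology euclidean f \<and> x \<in> seq_torus \<and>
      \<not> convergent (\<lambda>n. (1 / of_nat (r n)) * (\<Sum>i<r n. of_nat (power_count C (r n) (int i)) * f ((seq_skew p ^^ i) x)))"
    using div avg_eq by (intro exI[of _ "\<lambda>s. snd (of_seq s)"] exI[of _ "seq_of (1, 1)"]) simp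
  moreover have "\<forall>m n. m \<noteq> n \<longrightarrow> coprime (r m) (r n)"
    using cop by (metis coprime_commute nat_neq_iff)
  moreover have "filterlim r at_top sequentially" using mono by (rule filterlim_subseq)
  moreover have "\<forall>n. r n > 0 \<and> squarefree (r n)" "\<forall>n. real (num_prime_divisors (r n)) < h2 (r n)"
    using pos r_eq R(2,4) by metis+
  ultimately show ?thesis
    using tue q(1) small
    by (intro exI[of _ seq_torus] exI[of _ seq_dist] exI[of _ "seq_skew p"] exI[of _ q] exI[of _ r] conjI) auto
qed

end
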